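(* Let $\Gamma$ be one of the classical $ADE$ Dynkin diagrams (with at least one edge), with Coxeter number $h$, and put $\lambda=\pi/h$, so that the Perron--Frobenius eigenvalue of $\Gamma$ is $\bar\kappa_\Gamma=2\cos\lambda$. The parametrization $x=f(z)=\frac{\sin z}{\sin(\lambda-z)}$ satisfies, with $x=f(z)$, $x'=f(z')$, $x''=f(z'')$, $z''=z'-z$ (for generic $z,z'$), $$x''=\frac{x'-x}{1+\bar\kappa_\Gamma x+xx'},$$ and $\check R(z,a):=\mathrm{id}+\frac{\sin z}{\sin(\lambda-z)}T_\Gamma(a)$ satisfies the dynamical Yang--Baxter equation: for all vertices $a$ of $\Gamma$ and generic $z,w\in\mathbb{C}$, $$\check R^{(23)}(z-w,ah^{(1)})\,\check R^{(12)}(z,a)\,\check R^{(23)}(w,ah^{(1)})=\check R^{(12)}(w,a)\,\check R^{(23)}(z,ah^{(1)})\,\check R^{(12)}(z-w,a).$$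
   Context: Coxeter numbers: $A_L$: $h=L+1$; $D_L$: $h=2L-2$; $E_6$: $12$; $E_7$: $18$; $E_8$: $30$. The groupoid $\pi(\Gamma)$ has the vertices of $\Gamma$ as objects; each unoriented edge gives two mutually inverse arrows (one in each direction), and the arrows of $\pi(\Gamma)$ are those formed by their compositions (the free groupoid on the graph); $s,t$ denote source and target. For adjacent vertices $d,a$ let $(d,a)$ be the edge arrow from $d$ to $a$. Let $V$ be the $\pi(\Gamma)$-graded vector space with $V_{(d,a)}=\mathbb{C}e_{(d,a)}$ for all adjacent $d,a$ and $V_\alpha=0$ for other arrows. Tensor products: $(V\otimes W)_\gamma=\bigoplus_{\beta\circ\alpha=\gamma}V_\alpha\otimes W_\beta$. Let $Y$ be the adjacency matrix of $\Gamma$ and $(S_i)$ its Perron--Frobenius eigenvector (positive entries, eigenvalue $2\cos\lambda$). $T_\Gamma(d)$ acts on the source fiber $\bigoplus_{\alpha\in s^{-1}(d)}(V\otimes V)_\alpha$ by $$T_\Gamma(d)(e_{(d,a)}\otimes e_{(a,d)})=\sum_{c\text{ adjacent to }d}\sqrt{\tfrac{S_aS_c}{S_dS_d}}\;e_{(d,c)}\otimes e_{(c,d)},\qquad T_\Gamma(d)(e_{(d,a)}\otimes e_{(a,b)})=0\ (b\ne d).$$ For a family $X(a)\in\bigoplus_{\alpha\in s^{-1}(a)}\mathrm{End}_{\mathbb{C}}((V\otimes V)_\alpha)$ and $u\otimes v\otimes w\in V_{\alpha_1}\otimes V_{\alpha_2}\otimes V_{\alpha_3}$ with composable arrows and $s(\alpha_1)=a$,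 set $X^{(12)}(a)(u\otimes v\otimes w)=X(a)(u\otimes v)\otimes w$ and $X^{(23)}(ah^{(1)})(u\otimes v\otimes w)=u\otimes X(t(\alpha_1))(v\otimes w)$. *)

theory Defs
  imports
    "HOL-Library.Poly_Mapping"
    "Graph_Theory.Graph_Theory"
    "Jordan_Normal_Form.Spectral_Radius"
begin

section \<open>Dynkin diagrams of type ADE\<close>

datatype ade = type_A nat | type_D nat | type_E6 | type_E7 | type_E8

fun is_dynkin :: "ade \<Rightarrow> bool" where
  "is_dynkin (type_A L) \<longleftrightarrow> 1 \<le> L"
| "is_dynkin (type_D L) \<longleftrightarrow> 4 \<le> L"
| "is_dynkin type_E6 \<longleftrightarrow> True"
| "is_dynkin type_E7 \<longleftrightarrow> True"
| "is_dynkin type_E8 \<longleftrightarrow> True"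

fun dynkin_rank :: "ade \<Rightarrow> nat" where
  "dynkin_rank (type_A L) = L"
| "dynkin_rank (type_D L) = L"
| "dynkin_rank type_E6 = 6"
| "dynkin_rank type_E7 = 7"
| "dynkin_rank type_E8 = 8"

fun coxeter_number :: "ade \<Rightarrow> nat" where
  "coxeter_number (type_A L) = L + 1"
| "coxeter_number (type_D L) = 2 * L - 2"
| "coxeter_number type_E6 = 12"
| "coxeter_number type_E7 = 18"
| "coxeter_number type_E8 = 30"

definition chain :: "nat \<Rightarrow> nat rel" where
  "chain n = {(i, i + 1) | i. i + 1 < n}"

text \<open>One orientation of every edge, on the vertices \<open>0, \<dots>, n - 1\<close>.  For \<open>D\<close> and \<open>E\<close> the
  last vertex is the one off the chain.\<close>

fun dynkin_edges :: "ade \<Rightarrow> nat rel" where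
  "dynkin_edges (type_A L) = chain L"
| "dynkin_edges (type_D L) = insert (L - 3, L - 1) (chain (L - 1))"
| "dynkin_edges type_E6 = insert (2, 5) (chain 5)"
| "dynkin_edges type_E7 = insert (2, 6) (chain 6)"
| "dynkin_edges type_E8 = insert (2, 7) (chain 7)"

text \<open>An unoriented edge \<open>{d, a}\<close> is the pair of arcs \<open>(d, a)\<close>, \<open>(a, d)\<close>.\<close>

definition dynkin_graph :: "ade \<Rightarrow> nat pair_pre_digraph" where
  "dynkin_graph X = \<lparr> pverts = {..<dynkin_rank X}, parcs = dynkin_edges X \<union> (dynkin_edges X)\<inverse> \<rparr>"

section \<open>Adjacency matrix and Perron--Frobenius data\<close>

text \<open>For graphs whose vertex set is an initial segment of the natural numbers.\<close>

definition adjacency_matrix :: "nat pair_pre_digraph \<Rightarrow> 'a::zero_neq_one mat" where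
  "adjacency_matrix G =
     mat (card (pverts G)) (card (pverts G)) (\<lambda>(i, j). if (i, j) \<in> parcs G then 1 else 0)"

definition pf_eigenvalue :: "nat pair_pre_digraph \<Rightarrow> real" where
  "pf_eigenvalue G = spectral_radius (adjacency_matrix G)"

definition pf_eigenvector :: "nat pair_pre_digraph \<Rightarrow> real vec \<Rightarrow> bool" where
  "pf_eigenvector G S \<longleftrightarrow>
     eigenvector (adjacency_matrix G) S (pf_eigenvalue G) \<and> (\<forall>i < dim_vec S. 0 < S $ i)"

section \<open>The free groupoid on a graph\<close>

text \<open>An arrow is a walk, given by its list of vertices, modulo insertion and deletion of
  backtracking pieces \<open>x, y, x\<close>; so the two orientations of an edge become mutually inverse.\<close>

inductive backtrack :: "'v pair_pre_digraph \<Rightarrow> 'v list \<Rightarrow> 'v list \<Rightarrow> bool"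
  for G :: "'v pair_pre_digraph" where
  "vwalk (p @ [x, y, x] @ q) (with_proj G) \<Longrightarrow> backtrack G (p @ [x, y, x] @ q) (p @ [x] @ q)"

definition walk_arrow :: "'v pair_pre_digraph \<Rightarrow> 'v list \<Rightarrow> 'v list set" where
  "walk_arrow G p = {q. equivclp (backtrack G) p q}"

definition arrows :: "'v pair_pre_digraph \<Rightarrow> 'v list set set" where
  "arrows G = {walk_arrow G p | p. vwalk p (with_proj G)}"

definition gsource :: "'v list set \<Rightarrow> 'v" where
  "gsource \<alpha> = (THE d. \<forall>p \<in> \<alpha>. hd p = d)"

definition gtarget :: "'v list set \<Rightarrow> 'v" where
  "gtarget \<alpha> = (THE d. \<forall>p \<in> \<alpha>. last p = d)"

text \<open>\<open>gcompose G \<beta> \<alpha>\<close> is \<open>\<beta> \<circ> \<alpha>\<close>: first \<open>\<alpha>\<close>, then \<open>\<beta>\<close>.\<close>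

definition gcompose :: "'v pair_pre_digraph \<Rightarrow> 'v list set \<Rightarrow> 'v list set \<Rightarrow> 'v list set" where
  "gcompose G \<beta> \<alpha> = (\<Union>p \<in> \<alpha>. \<Union>q \<in> \<beta>. walk_arrow G (vwalk_join p q))"

definition edge_arrow :: "'v pair_pre_digraph \<Rightarrow> 'v \<times> 'v \<Rightarrow> 'v list set" where
  "edge_arrow G e = walk_arrow G [fst e, snd e]"

section \<open>Complex vector spaces with a basis\<close>

text \<open>The space with basis \<open>B\<close> is the set of finitely supported functions on \<open>B\<close>.\<close>

definition vscale :: "complex \<Rightarrow> ('b \<Rightarrow>\<^sub>0 complex) \<Rightarrow> ('b \<Rightarrow>\<^sub>0 complex)" where
  "vscale c v = Poly_Mapping.map ((*) c) v"

lemma lookup_vscale [simp]: "Poly_Mapping.lookup (vscale c v) b = c * Poly_Mapping.lookup v b"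
  by (simp add: vscale_def map.rep_eq when_def)

interpretation free_vs: vector_space "vscale :: complex \<Rightarrow> ('b \<Rightarrow>\<^sub>0 complex) \<Rightarrow> _"
  by unfold_locales (auto intro!: poly_mapping_eqI simp: lookup_add algebra_simps)

definition bvec :: "'b \<Rightarrow> ('b \<Rightarrow>\<^sub>0 complex)" where
  "bvec b = Poly_Mapping.single b 1"

definition lin_ext :: "('b \<Rightarrow> ('c \<Rightarrow>\<^sub>0 complex)) \<Rightarrow> ('b \<Rightarrow>\<^sub>0 complex) \<Rightarrow> ('c \<Rightarrow>\<^sub>0 complex)" where
  "lin_ext f v = (\<Sum>b \<in> Poly_Mapping.keys v. vscale (Poly_Mapping.lookup v b) (f b))"

definition vtensor :: "('b \<Rightarrow>\<^sub>0 complex) \<Rightarrow> ('c \<Rightarrow>\<^sub>0 complex) \<Rightarrow> ('b \<times> 'c \<Rightarrow>\<^sub>0 complex)"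
    (infixr \<open>\<otimes>\<^sub>v\<close> 75) where
  "u \<otimes>\<^sub>v v = lin_ext (\<lambda>x. lin_ext (\<lambda>y. bvec (x, y)) v) u"

definition vassoc :: "(('b \<times> 'c) \<times> 'd \<Rightarrow>\<^sub>0 complex) \<Rightarrow> ('b \<times> 'c \<times> 'd \<Rightarrow>\<^sub>0 complex)" where
  "vassoc = lin_ext (\<lambda>((x, y), z). bvec (x, y, z))"

section \<open>Graded vector spaces over the groupoid\<close>

text \<open>A graded vector space is given by a basis of homogeneous vectors and their grades.\<close>

record ('b, 'v) graded_space =
  hbasis :: "'b set"
  grade :: "'b \<Rightarrow> 'v list set"

definition component :: "('b, 'v) graded_space \<Rightarrow> 'v list set \<Rightarrow> ('b \<Rightarrow>\<^sub>0 complex) set" where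
  "component W \<alpha> = {w. Poly_Mapping.keys w \<subseteq> {b \<in> hbasis W. grade W b = \<alpha>}}"

definition gtensor :: "'v pair_pre_digraph \<Rightarrow> ('b, 'v) graded_space \<Rightarrow> ('c, 'v) graded_space
    \<Rightarrow> ('b \<times> 'c, 'v) graded_space" where
  "gtensor G V W =
     \<lparr> hbasis = {(x, y) \<in> hbasis V \<times> hbasis W. gtarget (grade V x) = gsource (grade W y)},
       grade = (\<lambda>(x, y). gcompose G (grade W y) (grade V x)) \<rparr>"

text \<open>The direct sum of the components whose grade has source \<open>d\<close>.\<close>

definition source_fiber ::
    "'v pair_pre_digraph \<Rightarrow> ('b, 'v) graded_space \<Rightarrow> 'v \<Rightarrow> ('b \<Rightarrow>\<^sub>0 complex) set" where
  "source_fiber G W d = free_vs.span (\<Union>\<alpha> \<in> {\<alpha> \<in> arrows G. gsource \<alpha> = d}. component W \<alpha>)"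

text \<open>\<open>F\<close> induces an element of the direct sum of the \<open>End (component W \<alpha>)\<close>, \<open>gsource \<alpha> = d\<close>.
  As everywhere below, the values of \<open>F\<close> outside the source fiber at \<open>d\<close> are irrelevant.\<close>

definition fiber_endo :: "'v pair_pre_digraph \<Rightarrow> ('b, 'v) graded_space \<Rightarrow> 'v
    \<Rightarrow> (('b \<Rightarrow>\<^sub>0 complex) \<Rightarrow> ('b \<Rightarrow>\<^sub>0 complex)) \<Rightarrow> bool" where
  "fiber_endo G W d F \<longleftrightarrow> Vector_Spaces.linear vscale vscale F \<and>
     (\<forall>\<alpha> \<in> arrows G. gsource \<alpha> = d \<longrightarrow> F ` component W \<alpha> \<subseteq> component W \<alpha>)"

text \<open>\<open>(x, y, z)\<close> is \<open>(x, (y, z))\<close>, hence the reassociation in \<open>op12\<close>.\<close>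

definition op12 :: "('v \<Rightarrow> ('b \<times> 'b \<Rightarrow>\<^sub>0 complex) \<Rightarrow> ('b \<times> 'b \<Rightarrow>\<^sub>0 complex)) \<Rightarrow> 'v
    \<Rightarrow> ('b \<times> 'b \<times> 'b \<Rightarrow>\<^sub>0 complex) \<Rightarrow> ('b \<times> 'b \<times> 'b \<Rightarrow>\<^sub>0 complex)" where
  "op12 X a = lin_ext (\<lambda>(x, y, z). vassoc (X a (bvec x \<otimes>\<^sub>v bvec y) \<otimes>\<^sub>v bvec z))"

text \<open>This is \<open>X^(23)(a h^(1))\<close>: the argument of \<open>X\<close> is the target of the grade of the first
  factor, and \<open>a\<close> enters only as the source of that grade, through the fiber acted on.\<close>

definition op23 :: "('b, 'v) graded_space
    \<Rightarrow> ('v \<Rightarrow> ('b \<times> 'b \<Rightarrow>\<^sub>0 complex) \<Rightarrow> ('b \<times> 'b \<Rightarrow>\<^sub>0 complex))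
    \<Rightarrow> ('b \<times> 'b \<times> 'b \<Rightarrow>\<^sub>0 complex) \<Rightarrow> ('b \<times> 'b \<times> 'b \<Rightarrow>\<^sub>0 complex)" where
  "op23 V X = lin_ext (\<lambda>(x, y, z). bvec x \<otimes>\<^sub>v X (gtarget (grade V x)) (bvec y \<otimes>\<^sub>v bvec z))"

section \<open>The operators attached to a graph\<close>

definition edge_space :: "'v pair_pre_digraph \<Rightarrow> ('v \<times> 'v, 'v) graded_space" where
  "edge_space G = \<lparr> hbasis = parcs G, grade = edge_arrow G \<rparr>"

definition T_op :: "nat pair_pre_digraph \<Rightarrow> real vec \<Rightarrow> nat
    \<Rightarrow> ((nat \<times> nat) \<times> (nat \<times> nat) \<Rightarrow>\<^sub>0 complex) \<Rightarrow> ((nat \<times> nat) \<times> (nat \<times> nat) \<Rightarrow>\<^sub>0 complex)" where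
  "T_op G S d = lin_ext (\<lambda>((d', a), (a', b)).
     if d' = d \<and> a' = a \<and> b = d
     then \<Sum>c \<in> {c. (d, c) \<in> parcs G}.
            vscale (complex_of_real (sqrt (S $ a * S $ c / (S $ d * S $ d))))
              (bvec (d, c) \<otimes>\<^sub>v bvec (c, d))
     else 0)"

definition f_param :: "real \<Rightarrow> complex \<Rightarrow> complex" where
  "f_param lam z = sin z / sin (complex_of_real lam - z)"

definition R_check :: "nat pair_pre_digraph \<Rightarrow> real vec \<Rightarrow> real \<Rightarrow> complex \<Rightarrow> nat
    \<Rightarrow> ((nat \<times> nat) \<times> (nat \<times> nat) \<Rightarrow>\<^sub>0 complex) \<Rightarrow> ((nat \<times> nat) \<times> (nat \<times> nat) \<Rightarrow>\<^sub>0 complex)" where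
  "R_check G S lam z a v = v + vscale (f_param lam z) (T_op G S a v)"

section \<open>The operators act as intended\<close>

text \<open>\<open>T_op\<close> and \<open>R_check\<close> preserve every component with source \<open>d\<close> (\<open>T_op_fiber_endo\<close>,
  \<open>R_check_fiber_endo\<close>), and \<open>op12\<close>, \<open>op23\<close> satisfy the expected formulas on arbitrary
  decomposable tensors (\<open>op12_vtensor\<close>, \<open>op23_vtensor\<close>).\<close>

lemma vwalk_join_walk:
  assumes "vwalk p (with_proj G)" "vwalk r (with_proj G)" "last p = hd r"
  shows "vwalk (vwalk_join p r) (with_proj G)"
proof (cases "tl r")
  case Nil then show ?thesis using assms by (simp add: vwalk_join_def)
next
  case (Cons b r')
  then have r: "r = hd r # b # r'" by (cases r) auto
  have "set (vwalk_arcs (p @ b # r')) = set (vwalk_arcs p) \<union> {(last p, b)} \<union> set (vwalk_arcs (b # r'))"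
    using assms(1) by (subst vwalk_arcs_append) auto
  moreover have "set (vwalk_arcs r) = insert (hd r, b) (set (vwalk_arcs (b # r')))"
    by (subst r) simp
  moreover have "set r = insert (hd r) (set (b # r'))" by (subst r) simp
  ultimately show ?thesis using assms Cons
    by (auto simp: vwalk_def vwalk_join_def)
qed

lemma backtrack_props:
  assumes "backtrack G p q"
  shows "vwalk p (with_proj G) \<and> vwalk q (with_proj G) \<and> hd p = hd q \<and> last p = last q"
  using assms
proof cases
  case (1 p' x y q')
  have "vwalk (p' @ [x]) (with_proj G)" "vwalk (x # q') (with_proj G)"
    using vwalkI_append_l[of "p' @ [x]" "[y,x] @ q'" "with_proj G"]
      vwalkI_append_r[of "x # q'" "p' @ [x,y]" "with_proj G"] 1 by auto
  then have "vwalk (p' @ [x] @ q') (with_proj G)"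
    using vwalk_join_walk[of "p' @ [x]" G "x # q'"] by (simp add: vwalk_join_def)
  then show ?thesis using 1 by (cases p') auto
qed

lemma equiv_props:
  assumes "equivclp (backtrack G) p q" "vwalk p (with_proj G)"
  shows "vwalk q (with_proj G) \<and> hd q = hd p \<and> last q = last p"
  using assms by (induction) (auto dest: backtrack_props)

lemma walk_arrow_self: "p \<in> walk_arrow G p"
  by (simp add: walk_arrow_def)

lemma gsource_walk_arrow: "vwalk p (with_proj G) \<Longrightarrow> gsource (walk_arrow G p) = hd p"
  unfolding gsource_def
proof (rule the_equality)
  assume w: "vwalk p (with_proj G)"
  show "\<forall>q \<in> walk_arrow G p. hd q = hd p"
    using equiv_props[OF _ w] unfolding walk_arrow_def by fast
  then show "d = hd p" if "\<forall>q \<in> walk_arrow G p. hd q = d" for d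
    using that walk_arrow_self[of p G] by metis
qed

lemma gtarget_walk_arrow: "vwalk p (with_proj G) \<Longrightarrow> gtarget (walk_arrow G p) = last p"
  unfolding gtarget_def
proof (rule the_equality)
  assume w: "vwalk p (with_proj G)"
  show "\<forall>q \<in> walk_arrow G p. last q = last p"
    using equiv_props[OF _ w] unfolding walk_arrow_def by fast
  then show "d = last p" if "\<forall>q \<in> walk_arrow G p. last q = d" for d
    using that walk_arrow_self[of p G] by metis
qed

lemma join_cong1:
  assumes "equivclp (backtrack G) p q" "vwalk p (with_proj G)" "vwalk r (with_proj G)" "last p = hd r"
  shows "equivclp (backtrack G) (vwalk_join p r) (vwalk_join q r)"
  using assms
proof induction
  case (step y z)
  have st: "backtrack G (vwalk_join a r) (vwalk_join b r)" if "backtrack G a b" "last a = hd r" for a b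
    using that(1)
  proof cases
    case (1 p' x y q')
    have "vwalk (vwalk_join a r) (with_proj G)" using that backtrack_props[OF that(1)] step.prems
      by (intro vwalk_join_walk) auto
    then show ?thesis using backtrack.intros[of p' x y "q' @ tl r" G] 1
      by (simp add: vwalk_join_def)
  qed
  have "last y = hd r" "last z = hd r"
    using step equiv_props[of G p y] by (auto dest: backtrack_props)
  with st step show ?case
    by (meson equivclp_trans r_into_equivclp converse_r_into_equivclp)
qed simp

lemma join_cong2:
  assumes "equivclp (backtrack G) p q" "vwalk p (with_proj G)" "vwalk r (with_proj G)" "last r = hd p"
  shows "equivclp (backtrack G) (vwalk_join r p) (vwalk_join r q)"
  using assms
proof induction
  case (step y z)
  have st: "backtrack G (vwalk_join r a) (vwalk_join r b)" if "backtrack G a b" "last r = hd a" for a b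
    using that(1)
  proof cases
    case (1 p' x y q')
    have w: "vwalk (vwalk_join r a) (with_proj G)" using that backtrack_props[OF that(1)] step.prems
      by (intro vwalk_join_walk) auto
    have r: "r = butlast r @ [last r]"
      using step.prems(2) by (metis append_butlast_last_id vwalk_def)
    show ?thesis
    proof (cases p')
      case Nil
      then have "last r = x" using 1 that by simp
      then have "vwalk_join r a = butlast r @ [x,y,x] @ q'" "vwalk_join r b = butlast r @ [x] @ q'"
        using 1 Nil r by (simp_all add: vwalk_join_def)
      then show ?thesis using w backtrack.intros by metis
    next
      case (Cons h t)
      then show ?thesis using 1 w backtrack.intros[of "r @ t" x y q' G]
        by (simp add: vwalk_join_def)
    qed
  qed
  have "last r = hd y" "last r = hd z"
    using step equiv_props[of G p y] by (auto dest: backtrack_props)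
  with st step show ?case
    by (meson equivclp_trans r_into_equivclp converse_r_into_equivclp)
qed simp

lemma walk_arrow_eq: "equivclp (backtrack G) p q \<Longrightarrow> walk_arrow G p = walk_arrow G q"
  unfolding walk_arrow_def by (rule Collect_cong) (meson equivclp_trans equivclp_sym)

lemma gcompose_walk_arrow:
  assumes "vwalk p (with_proj G)" "vwalk q (with_proj G)" "last p = hd q"
  shows "gcompose G (walk_arrow G q) (walk_arrow G p) = walk_arrow G (vwalk_join p q)"
proof -
  have "walk_arrow G (vwalk_join p' q') = walk_arrow G (vwalk_join p q)"
    if "p' \<in> walk_arrow G p" "q' \<in> walk_arrow G q" for p' q'
  proof -
    have e: "equivclp (backtrack G) p p'" "equivclp (backtrack G) q q'"
      using that by (auto simp: walk_arrow_def)
    note w = equiv_props[OF e(1) assms(1)] equiv_props[OF e(2) assms(2)]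
    have "equivclp (backtrack G) (vwalk_join p q) (vwalk_join p' q)"
      using e assms by (intro join_cong1) auto
    moreover have "equivclp (backtrack G) (vwalk_join p' q) (vwalk_join p' q')"
      using e assms w by (intro join_cong2) auto
    ultimately show ?thesis by (simp only: walk_arrow_eq)
  qed
  then have *: "p' \<in> walk_arrow G p \<Longrightarrow> q' \<in> walk_arrow G q \<Longrightarrow>
    walk_arrow G (vwalk_join p' q') = walk_arrow G (vwalk_join p q)" for p' q' .
  show ?thesis
  proof (intro equalityI subsetI)
    fix r assume "r \<in> gcompose G (walk_arrow G q) (walk_arrow G p)"
    then obtain p' q' where "p' \<in> walk_arrow G p" "q' \<in> walk_arrow G q"
      "r \<in> walk_arrow G (vwalk_join p' q')" unfolding gcompose_def by (elim UN_E)
    with * show "r \<in> walk_arrow G (vwalk_join p q)" by (simp only:)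
  qed (unfold gcompose_def, rule UN_I[OF walk_arrow_self], rule UN_I[OF walk_arrow_self])
qed

lemma edge_inverse:
  assumes "pair_graph G" "(d, c) \<in> parcs G"
  shows "gcompose G (edge_arrow G (c, d)) (edge_arrow G (d, c)) = walk_arrow G [d]"
proof -
  interpret pair_graph G by fact
  have cd: "(c, d) \<in> parcs G" using assms arcs_symmetric by blast
  have v: "c \<in> pverts G" "d \<in> pverts G" using assms in_arcsD1 in_arcsD2 by auto
  have "gcompose G (edge_arrow G (c, d)) (edge_arrow G (d, c)) = walk_arrow G [d, c, d]"
    unfolding edge_arrow_def using v cd assms
    by (subst gcompose_walk_arrow) (auto simp: vwalk_def vwalk_join_def)
  also have "\<dots> = walk_arrow G [d]"
    using backtrack.intros[of "[]" d c "[]" G] v cd assms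
    by (intro walk_arrow_eq) (auto simp: vwalk_def)
  finally show ?thesis .
qed

lemma lin_ext_superset:
  assumes "finite K" "Poly_Mapping.keys v \<subseteq> K"
  shows "lin_ext f v = (\<Sum>b\<in>K. vscale (Poly_Mapping.lookup v b) (f b))"
  unfolding lin_ext_def using assms
  by (intro sum.mono_neutral_left) (auto simp: in_keys_iff)

lemma lin_ext_linear: "Vector_Spaces.linear vscale vscale (lin_ext f)"
proof unfold_locales
  fix u v :: "'a \<Rightarrow>\<^sub>0 complex" and c
  let ?K = "Poly_Mapping.keys u \<union> Poly_Mapping.keys v"
  have k: "finite ?K" "Poly_Mapping.keys (u+v) \<subseteq> ?K" "Poly_Mapping.keys u \<subseteq> ?K" "Poly_Mapping.keys v \<subseteq> ?K"
    by (auto simp: Poly_Mapping.keys_add)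
  show "lin_ext f (u + v) = lin_ext f u + lin_ext f v"
    by (simp add: lin_ext_superset[OF k(1,2)] lin_ext_superset[OF k(1,3)] lin_ext_superset[OF k(1,4)]
        lookup_add free_vs.scale_left_distrib sum.distrib)
  have k': "Poly_Mapping.keys (vscale c u) \<subseteq> Poly_Mapping.keys u" by (auto simp: in_keys_iff)
  show "lin_ext f (vscale c u) = vscale c (lin_ext f u)"
    by (simp add: lin_ext_superset[OF finite_keys k'] lin_ext_def[of f u] free_vs.scale_sum_right)
qed

lemma lin_ext_bvec: "lin_ext f (bvec b) = f b"
  by (simp add: lin_ext_def bvec_def)

lemma vtensor_bvec: "bvec x \<otimes>\<^sub>v bvec y = bvec (x, y)"
  by (simp add: vtensor_def lin_ext_bvec)

lemma component_subspace: "free_vs.subspace (component W \<alpha>)"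
proof -
  have "component W \<alpha> = {w. \<forall>b. b \<notin> {b \<in> hbasis W. grade W b = \<alpha>} \<longrightarrow> Poly_Mapping.lookup w b = 0}"
    unfolding component_def by (auto simp: in_keys_iff subset_iff)
  then show ?thesis by (auto simp: free_vs.subspace_def lookup_add)
qed

theorem T_op_fiber_endo:
  assumes "pair_graph G"
  shows "fiber_endo G (gtensor G (edge_space G) (edge_space G)) d (T_op G S d)"
  unfolding fiber_endo_def
proof (intro conjI ballI impI subsetI)
  interpret pair_graph G by fact
  show "Vector_Spaces.linear vscale vscale (T_op G S d)"
    unfolding T_op_def by (rule lin_ext_linear)
  let ?VV = "gtensor G (edge_space G) (edge_space G)"
  fix \<alpha> w assume "w \<in> T_op G S d ` component ?VV \<alpha>"
  then obtain v where v: "Poly_Mapping.keys v \<subseteq> {b \<in> hbasis ?VV. grade ?VV b = \<alpha>}" and w: "w = T_op G S d v"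
    by (auto simp: component_def)
  have src: "gsource (edge_arrow G (x, y)) = x" "gtarget (edge_arrow G (x, y)) = y" if "(x, y) \<in> parcs G" for x y
  proof -
    have "vwalk [x, y] (with_proj G)"
      using that in_arcsD1[OF that] in_arcsD2[OF that] by (simp add: vwalk_def)
    then show "gsource (edge_arrow G (x, y)) = x" "gtarget (edge_arrow G (x, y)) = y"
      by (simp_all add: edge_arrow_def gsource_walk_arrow gtarget_walk_arrow)
  qed
  show "w \<in> component ?VV \<alpha>"
    unfolding w T_op_def lin_ext_def
  proof (rule free_vs.subspace_sum[OF component_subspace], rule free_vs.subspace_scale[OF component_subspace], clarify)
    fix d' a a' b assume "((d', a), (a', b)) \<in> Poly_Mapping.keys v"
    then have b: "((d', a), (a', b)) \<in> hbasis ?VV" "grade ?VV ((d', a), (a', b)) = \<alpha>" using v by auto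
    show "(if d' = d \<and> a' = a \<and> b = d
     then \<Sum>c \<in> {c. (d, c) \<in> parcs G}.
            vscale (complex_of_real (sqrt (S $ a * S $ c / (S $ d * S $ d))))
              (bvec (d, c) \<otimes>\<^sub>v bvec (c, d))
     else 0) \<in> component ?VV \<alpha>"
    proof (cases "d' = d \<and> a' = a \<and> b = d")
      case True
      have da: "(d, a) \<in> parcs G" using b(1) True by (simp add: gtensor_def edge_space_def)
      have "\<alpha> = gcompose G (edge_arrow G (a, d)) (edge_arrow G (d, a))"
        using b(2) True by (simp add: gtensor_def edge_space_def)
      then have al: "\<alpha> = walk_arrow G [d]" using edge_inverse[OF assms da] by simp
      have "bvec (d, c) \<otimes>\<^sub>v bvec (c, d) \<in> component ?VV \<alpha>" if dc: "(d, c) \<in> parcs G" for c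
      proof -
        have cd: "(c, d) \<in> parcs G" using dc arcs_symmetric by blast
        have "((d, c), (c, d)) \<in> {b \<in> hbasis ?VV. grade ?VV b = \<alpha>}"
          using dc cd src[OF dc] src[OF cd] edge_inverse[OF assms dc] al
          by (simp add: gtensor_def edge_space_def)
        then show ?thesis unfolding vtensor_bvec by (simp add: component_def bvec_def)
      qed
      then show ?thesis using True
        by (simp only: simp_thms if_True)
          (intro free_vs.subspace_sum[OF component_subspace]
            free_vs.subspace_scale[OF component_subspace], simp)
    qed (simp only: if_False free_vs.subspace_0[OF component_subspace])
  qed
qed

lemma dynkin_graph_pair_graph:
  assumes "is_dynkin X" shows "pair_graph (dynkin_graph X)"
proof unfold_locales
  show "finite (parcs (dynkin_graph X))"
    by (rule finite_subset[of _ "{..<dynkin_rank X} \<times> {..<dynkin_rank X}"])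
       (use assms in \<open>cases X; auto simp: dynkin_graph_def chain_def\<close>)+
qed (use assms in \<open>cases X; auto simp: dynkin_graph_def chain_def symmetric_def sym_def\<close>)+

lemma linear_lin_ext:
  assumes "Vector_Spaces.linear vscale vscale F"
  shows "F (lin_ext g u) = lin_ext (\<lambda>x. F (g x)) u"
proof -
  interpret Vector_Spaces.linear vscale vscale F by fact
  show ?thesis by (simp add: lin_ext_def sum scale)
qed

lemma lin_ext_swap:
  "lin_ext (\<lambda>x. lin_ext (\<lambda>y. f x y) v) u = lin_ext (\<lambda>y. lin_ext (\<lambda>x. f x y) u) v"
  unfolding lin_ext_def free_vs.scale_sum_right
  by (subst sum.swap) (simp add: mult.commute)

lemma lin_ext_vtensor: "lin_ext f (u \<otimes>\<^sub>v v) = lin_ext (\<lambda>x. lin_ext (\<lambda>y. f (x, y)) v) u"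
  by (simp add: vtensor_def linear_lin_ext[OF lin_ext_linear] lin_ext_bvec)

lemma lin_ext_bvec_id: "lin_ext bvec u = u"
  by (rule poly_mapping_eqI)
    (simp add: lin_ext_def Poly_Mapping.lookup_sum bvec_def lookup_single when_def sum.delta in_keys_iff if_distrib cong: if_cong)

lemma vtensor_lin_ext_left: "lin_ext g u \<otimes>\<^sub>v w = lin_ext (\<lambda>x. g x \<otimes>\<^sub>v w) u"
  unfolding vtensor_def by (rule linear_lin_ext[OF lin_ext_linear])

lemma vtensor_lin_ext_right: "p \<otimes>\<^sub>v lin_ext g w = lin_ext (\<lambda>z. p \<otimes>\<^sub>v g z) w"
  unfolding vtensor_def linear_lin_ext[OF lin_ext_linear] by (rule lin_ext_swap)

lemma linear_vtensor:
  assumes "Vector_Spaces.linear vscale vscale F"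
  shows "F (u \<otimes>\<^sub>v v) = lin_ext (\<lambda>x. lin_ext (\<lambda>y. F (bvec (x, y))) v) u"
  unfolding vtensor_def linear_lin_ext[OF assms] ..

lemma vassoc_vtensor: "vassoc (p \<otimes>\<^sub>v w) = lin_ext (\<lambda>z. vassoc (p \<otimes>\<^sub>v bvec z)) w"
proof -
  have "vassoc (p \<otimes>\<^sub>v lin_ext bvec w) = lin_ext (\<lambda>z. vassoc (p \<otimes>\<^sub>v bvec z)) w"
    unfolding vtensor_lin_ext_right vassoc_def by (rule linear_lin_ext[OF lin_ext_linear])
  then show ?thesis by (simp only: lin_ext_bvec_id)
qed

theorem op12_vtensor:
  assumes "Vector_Spaces.linear vscale vscale (X a)"
  shows "op12 X a (u \<otimes>\<^sub>v v \<otimes>\<^sub>v w) = vassoc (X a (u \<otimes>\<^sub>v v) \<otimes>\<^sub>v w)"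
proof -
  have "vassoc (X a (u \<otimes>\<^sub>v v) \<otimes>\<^sub>v w) =
      lin_ext (\<lambda>x. lin_ext (\<lambda>y. vassoc (X a (bvec (x, y)) \<otimes>\<^sub>v w)) v) u"
    unfolding linear_vtensor[OF assms] vtensor_lin_ext_left vassoc_def
      linear_lin_ext[OF lin_ext_linear] ..
  then show ?thesis
    by (simp only: op12_def lin_ext_vtensor prod.case vtensor_bvec flip: vassoc_vtensor)
qed

theorem op23_vtensor:
  assumes "u \<in> component V \<alpha>" "Vector_Spaces.linear vscale vscale (X (gtarget \<alpha>))"
  shows "op23 V X (u \<otimes>\<^sub>v v \<otimes>\<^sub>v w) = u \<otimes>\<^sub>v X (gtarget \<alpha>) (v \<otimes>\<^sub>v w)"
proof -
  have "op23 V X (u \<otimes>\<^sub>v v \<otimes>\<^sub>v w) =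
      lin_ext (\<lambda>x. lin_ext (\<lambda>y. lin_ext (\<lambda>z. bvec x \<otimes>\<^sub>v X (gtarget (grade V x)) (bvec (y, z))) w) v) u"
    by (simp only: op23_def lin_ext_vtensor prod.case vtensor_bvec)
  also have "\<dots> = lin_ext (\<lambda>x. lin_ext (\<lambda>y. lin_ext (\<lambda>z. bvec x \<otimes>\<^sub>v X (gtarget \<alpha>) (bvec (y, z))) w) v) u"
    unfolding lin_ext_def[of _ u] using assms(1) by (intro sum.cong) (auto simp: component_def)
  also have "\<dots> = lin_ext (\<lambda>x. bvec x \<otimes>\<^sub>v X (gtarget \<alpha>) (v \<otimes>\<^sub>v w)) u"
    by (simp only: linear_vtensor[OF assms(2)] vtensor_lin_ext_right)
  also have "\<dots> = u \<otimes>\<^sub>v X (gtarget \<alpha>) (v \<otimes>\<^sub>v w)"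
    by (simp only: lin_ext_bvec_id flip: vtensor_lin_ext_left)
  finally show ?thesis .
qed

theorem R_check_fiber_endo:
  assumes "pair_graph G"
  shows "fiber_endo G (gtensor G (edge_space G) (edge_space G)) d (R_check G S lam z d)"
proof -
  note T = T_op_fiber_endo[OF assms, of d S, unfolded fiber_endo_def]
  interpret T: Vector_Spaces.linear vscale vscale "T_op G S d" using T by blast
  have "Vector_Spaces.linear vscale vscale (R_check G S lam z d)"
    by unfold_locales (simp_all add: R_check_def T.add T.scale free_vs.scale_right_distrib mult.commute)
  moreover have "R_check G S lam z d v \<in> component W \<alpha>"
    if "v \<in> component W \<alpha>" "T_op G S d v \<in> component W \<alpha>" for v W \<alpha>
    unfolding R_check_def
    by (intro free_vs.subspace_add[OF component_subspace] free_vs.subspace_scale[OF component_subspace] that)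
  ultimately show ?thesis
    using T unfolding fiber_endo_def image_subset_iff by (simp only: simp_thms) blast
qed

end

theory Submission
  imports Defs
begin

text \<open>
  The dynamical Yang--Baxter equation comes from a representation of the Temperley--Lieb algebra
  on paths in the graph.  On the source fiber at \<open>a\<close> write \<open>E\<close> and \<open>F\<close> for the operators \<open>T\<close>
  acting on the first two and on the last two tensor factors.  A path with three edges that starts
  at \<open>a\<close> is sent by \<open>E\<close> to \<open>0\<close> unless it returns to \<open>a\<close> after two steps, and then to a
  combination of paths that differ in the second vertex; \<open>F\<close> does the same to the last two steps
  and the third vertex.  The coefficients at a vertex \<open>d\<close> form the rank one matrix
  \<open>\<surd>(S\<^sub>a S\<^sub>c) / S\<^sub>d\<close>.  Its trace is \<open>\<kappa>\<close>, as \<open>S\<close> is an eigenvector, so \<open>E\<^sup>2 = \<kappa> E\<close> and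
  \<open>F\<^sup>2 = \<kappa> F\<close>; the products of coefficients telescope in \<open>E F E = E\<close> and \<open>F E F = F\<close>
  (\<open>temperley_lieb_path\<close>, extended linearly in \<open>temperley_lieb_source_fiber\<close>).  With these relations
  the Yang--Baxter equation for \<open>1 + p F\<close>, \<open>1 + q E\<close>, \<open>1 + r F\<close> reduces to the scalar equation
  \<open>p (1 + \<kappa> r + r q) = q - r\<close> (\<open>yang_baxter_of_temperley_lieb\<close>).  For \<open>\<kappa> = 2 cos \<lambda>\<close> this is the
  addition law of \<open>z \<mapsto> sin z / sin (\<lambda> - z)\<close> (\<open>f_param_difference\<close>), a consequence of the addition
  theorems for the sine.

  It remains to see that the spectral radius of the adjacency matrix is \<open>2 cos (\<pi> / h)\<close>.  A positive
  eigenfunction of a symmetric graph belongs to the spectral radius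
  (\<open>positive_eigenfunction_perron_frobenius\<close>), so it suffices to exhibit one with this eigenvalue
  (\<open>dynkin_positive_eigenfunction\<close>).  On a chain it is \<open>sin (k \<pi> / h)\<close>.  On the diagrams with a
  branch vertex, three such sine functions, one for each arm, are scaled to agree at the branch
  vertex.  The eigenvalue equation there is a relation between sines of multiples of \<open>\<pi> / h\<close>, which
  follows from a known value of the sine or cosine at a multiple of this angle.
\<close>

section \<open>Positive eigenfunctions and the spectral radius\<close>

definition positive_eigenfunction :: "nat pair_pre_digraph \<Rightarrow> real \<Rightarrow> (nat \<Rightarrow> real) \<Rightarrow> bool" where
  "positive_eigenfunction G \<mu> f \<longleftrightarrow>
     (\<forall>i \<in> pverts G. 0 < f i \<and> (\<Sum>j | (i, j) \<in> parcs G. f j) = \<mu> * f i)"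

lemma adjacency_matrix_mult_vec:
  fixes v :: "'a::comm_ring_1 vec"
  assumes "pverts G = {..<n}" "parcs G \<subseteq> {..<n} \<times> {..<n}" "v \<in> carrier_vec n" "i < n"
  shows "(adjacency_matrix G *\<^sub>v v) $ i = (\<Sum>j | (i, j) \<in> parcs G. v $ j)"
proof -
  have "(adjacency_matrix G *\<^sub>v v) $ i = (\<Sum>j<n. if (i, j) \<in> parcs G then v $ j else 0)"
    using assms
    by (auto simp: adjacency_matrix_def scalar_prod_def atLeast0LessThan intro!: sum.cong)
  also have "\<dots> = (\<Sum>j | j \<in> {..<n} \<and> (i, j) \<in> parcs G. v $ j)"
    by (rule sum.inter_filter[symmetric]) simp
  also have "{j. j \<in> {..<n} \<and> (i, j) \<in> parcs G} = {j. (i, j) \<in> parcs G}"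
    using assms(2) by auto
  finally show ?thesis .
qed

lemma adjacency_eigenvector_iff:
  fixes v :: "'a::comm_ring_1 vec"
  assumes "pverts G = {..<n}" "parcs G \<subseteq> {..<n} \<times> {..<n}"
  shows "eigenvector (adjacency_matrix G) v k \<longleftrightarrow>
    v \<in> carrier_vec n \<and> v \<noteq> 0\<^sub>v n \<and> (\<forall>i<n. (\<Sum>j | (i, j) \<in> parcs G. v $ j) = k * v $ i)"
proof -
  have d: "dim_row (adjacency_matrix G :: 'a mat) = n"
    using assms(1) by (simp add: adjacency_matrix_def)
  have "adjacency_matrix G *\<^sub>v v = k \<cdot>\<^sub>v v \<longleftrightarrow>
      (\<forall>i<n. (\<Sum>j | (i, j) \<in> parcs G. v $ j) = k * v $ i)" if v: "v \<in> carrier_vec n"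
    using v d adjacency_matrix_mult_vec[OF assms v]
    by (auto simp: vec_eq_iff simp del: index_mult_mat_vec)
  then show ?thesis unfolding eigenvector_def d by blast
qed

text \<open>The positive function \<open>f\<close> serves as a weight.  Taking absolute values in the eigenvalue
  equation of \<open>v\<close> gives \<open>\<bar>k\<bar> \<bar>v i\<bar> \<le> \<Sum> \<bar>v j\<bar>\<close>, the sum running over the neighbours \<open>j\<close> of \<open>i\<close>.
  Summing these against \<open>f\<close> and moving the symmetric adjacency relation over to \<open>f\<close> turns the
  right-hand side into \<open>\<mu>\<close> times the weighted norm of \<open>v\<close>.\<close>

lemma norm_eigenvalue_le_positive_eigenvalue:
  assumes G: "pverts G = {..<n}" "parcs G \<subseteq> {..<n} \<times> {..<n}" "sym (parcs G)"
    and f: "positive_eigenfunction G \<mu> f"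
    and ev: "eigenvector (adjacency_matrix G) v (k :: complex)"
  shows "norm k \<le> \<mu>"
proof -
  note v = ev[unfolded adjacency_eigenvector_iff[OF G(1,2)]]
  define N where "N = (\<Sum>i<n. f i * norm (v $ i))"
  have pos: "0 < f i" if "i < n" for i
    using f that G(1) by (simp add: positive_eigenfunction_def)
  obtain i0 where i0: "i0 < n" "v $ i0 \<noteq> 0"
    using v by (metis carrier_vecD eq_vecI index_zero_vec(1,2))
  have Npos: "0 < N"
    unfolding N_def using i0 pos by (intro sum_pos2[of _ i0]) (auto simp: less_imp_le)
  have nb: "(\<Sum>j | (i, j) \<in> parcs G. g j) = (\<Sum>j<n. if (i, j) \<in> parcs G then g j else 0)"
    for i and g :: "nat \<Rightarrow> real"
  proof -
    have "{j. (i, j) \<in> parcs G} = {j. j \<in> {..<n} \<and> (i, j) \<in> parcs G}" using G(2) by auto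
    then show ?thesis using sum.inter_filter[of "{..<n}" g "\<lambda>j. (i, j) \<in> parcs G"] by simp
  qed
  have "norm k * N = (\<Sum>i<n. f i * norm (k * v $ i))"
    by (simp add: N_def sum_distrib_left norm_mult mult.left_commute)
  also have "\<dots> \<le> (\<Sum>i<n. f i * (\<Sum>j | (i, j) \<in> parcs G. norm (v $ j)))"
  proof (intro sum_mono mult_left_mono)
    fix i assume i: "i \<in> {..<n}"
    then have "k * v $ i = (\<Sum>j | (i, j) \<in> parcs G. v $ j)" using v by simp
    then show "norm (k * v $ i) \<le> (\<Sum>j | (i, j) \<in> parcs G. norm (v $ j))"
      by (simp add: norm_sum)
    show "0 \<le> f i" using pos i by (simp add: less_imp_le)
  qed
  also have "\<dots> = (\<Sum>i<n. \<Sum>j<n. if (i, j) \<in> parcs G then f i * norm (v $ j) else 0)"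
    by (simp add: nb sum_distrib_left if_distrib cong: if_cong)
  also have "\<dots> = (\<Sum>j<n. \<Sum>i<n. if (i, j) \<in> parcs G then f i * norm (v $ j) else 0)"
    by (rule sum.swap)
  also have "\<dots> = (\<Sum>j<n. norm (v $ j) * (\<Sum>i | (j, i) \<in> parcs G. f i))"
    using G(3) by (auto simp: nb sum_distrib_left sym_def intro!: sum.cong)
  also have "\<dots> = \<mu> * N"
    using f G(1) by (simp add: positive_eigenfunction_def N_def sum_distrib_left mult_ac)
  finally show ?thesis using Npos by simp
qed

text \<open>This makes the Perron--Frobenius eigenvalue computable: a positive eigenfunction known explicitly
  identifies the spectral radius, because its eigenvalue both occurs in the spectrum and bounds it.\<close>

lemma positive_eigenfunction_perron_frobenius:
  assumes G: "pverts G = {..<n}" "parcs G \<subseteq> {..<n} \<times> {..<n}" "sym (parcs G)" and n: "0 < n"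
    and f: "positive_eigenfunction G \<mu> f"
  shows "pf_eigenvalue G = \<mu>" and "pf_eigenvector G (vec n f)"
proof -
  let ?A = "adjacency_matrix G :: complex mat"
  have A: "?A \<in> carrier_mat n n" using G(1) by (simp add: adjacency_matrix_def)
  have pos: "0 < f i" and eq: "(\<Sum>j | (i, j) \<in> parcs G. f j) = \<mu> * f i" if "i < n" for i
    using f that G(1) by (simp_all add: positive_eigenfunction_def)
  have nbr: "j < n" if "(i, j) \<in> parcs G" for i j using that G(2) by auto
  have "0 \<le> \<mu> * f 0" unfolding eq[OF n, symmetric] using nbr pos
    by (intro sum_nonneg) (auto simp: less_imp_le)
  then have mu: "0 \<le> \<mu>" using pos[OF n] by (simp add: zero_le_mult_iff)
  have nz: "vec n (\<lambda>i. complex_of_real (f i)) \<noteq> 0\<^sub>v n" "vec n f \<noteq> 0\<^sub>v n"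
    using pos[OF n] n by (metis index_vec index_zero_vec(1) less_irrefl of_real_eq_0_iff)+
  have "eigenvector ?A (vec n (\<lambda>i. complex_of_real (f i))) (complex_of_real \<mu>)"
    unfolding adjacency_eigenvector_iff[OF G(1,2)] using nz eq nbr
    by (simp flip: of_real_mult of_real_sum)
  then have "complex_of_real \<mu> \<in> spectrum ?A"
    unfolding spectrum_def eigenvalue_def by blast
  then have "norm (complex_of_real \<mu>) \<in> norm ` spectrum ?A" by (rule imageI)
  then have ge: "\<mu> \<le> spectral_radius ?A"
    using spectral_radius_mem_max(2)[OF A n] mu by simp
  obtain k where k: "k \<in> spectrum ?A" "spectral_radius ?A = norm k"
    using spectral_radius_mem_max(1)[OF A n] by blast
  then have "spectral_radius ?A \<le> \<mu>"
    using norm_eigenvalue_le_positive_eigenvalue[OF G f]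
    unfolding spectrum_def eigenvalue_def by auto
  with ge show pf: "pf_eigenvalue G = \<mu>" unfolding pf_eigenvalue_def by simp
  have "eigenvector (adjacency_matrix G) (vec n f) \<mu>"
    unfolding adjacency_eigenvector_iff[OF G(1,2)] using nz eq nbr by simp
  then show "pf_eigenvector G (vec n f)"
    unfolding pf_eigenvector_def pf using pos by simp
qed

section \<open>Sine eigenfunctions on the Dynkin diagrams\<close>

text \<open>Along an arm of a diagram, sines of consecutive multiples of \<open>\<pi> / h\<close> satisfy the eigenvalue
  equation for \<open>2 cos (\<pi> / h)\<close>; the vanishing at multiple \<open>0\<close> accounts for the missing neighbour at
  the free end of the arm.\<close>

lemma sin_multiple_recurrence:
  "sin (real k * \<theta>) + sin (real (k + 2) * \<theta>) = 2 * cos \<theta> * sin (real (k + 1) * \<theta>)"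
proof -
  have "sin (real k * \<theta>) = sin (real (k + 1) * \<theta> - \<theta>)"
    "sin (real (k + 2) * \<theta>) = sin (real (k + 1) * \<theta> + \<theta>)"
    by (simp_all add: algebra_simps)
  then show ?thesis unfolding sin_diff sin_add by simp
qed

lemma sin_multiple_pos:
  assumes "0 < k" "k < h"
  shows "0 < sin (real k * (pi / real h))"
  using assms by (intro sin_gt_zero) (simp_all add: field_simps)

lemma chain_neighbour_sum:
  fixes f :: "nat \<Rightarrow> real"
  assumes "i < n"
  shows "(\<Sum>j | (i, j) \<in> chain n \<union> (chain n)\<inverse>. f j) =
    (if i = 0 then 0 else f (i - 1)) + (if i + 1 < n then f (i + 1) else 0)"
proof -
  have "{j. (i, j) \<in> chain n \<union> (chain n)\<inverse>} =
      (if i = 0 then {} else {i - 1}) \<union> (if i + 1 < n then {i + 1} else {})"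
    using assms by (auto simp: chain_def)
  then show ?thesis by auto
qed

lemma branched_chain_neighbour_sum:
  fixes f :: "nat \<Rightarrow> real"
  assumes "b < m" "i \<le> m" and E: "E = insert (b, m) (chain m)"
  shows "(\<Sum>j | (i, j) \<in> E \<union> E\<inverse>. f j) = (if i = m then f b else
    (if i = 0 then 0 else f (i - 1)) + (if i + 1 < m then f (i + 1) else 0) + (if i = b then f m else 0))"
proof (cases "i = m")
  case True
  then have "{j. (i, j) \<in> E \<union> E\<inverse>} = {b}" using assms by (auto simp: chain_def)
  then show ?thesis using True by simp
next
  case False
  define C where "C = {j. (i, j) \<in> chain m \<union> (chain m)\<inverse>}"
  have "{j. (i, j) \<in> E \<union> E\<inverse>} = C \<union> (if i = b then {m} else {})"
    using False assms by (auto simp: C_def)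
  moreover have "finite C" "m \<notin> C"
    unfolding C_def by (rule finite_subset[of _ "{..<m}"]) (auto simp: chain_def)
  moreover have "i < m" using False assms by simp
  ultimately show ?thesis using False chain_neighbour_sum[of i m f, folded C_def] by simp
qed

lemma chain_positive_eigenfunction:
  assumes h: "h = L + 1"
    and G: "pverts G = {..<L}" "parcs G = chain L \<union> (chain L)\<inverse>"
  shows "positive_eigenfunction G (2 * cos (pi / real h)) (\<lambda>i. sin (real (i + 1) * (pi / real h)))"
  unfolding positive_eigenfunction_def G
proof (intro ballI conjI)
  define s where "s k = sin (real k * (pi / real h))" for k
  fix i assume "i \<in> {..<L}"
  then have i: "i < L" by simp
  have ends: "s 0 = 0" "s h = 0" using h by (simp_all add: s_def)
  show "0 < sin (real (i + 1) * (pi / real h))" using i h by (intro sin_multiple_pos) auto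
  have "i + 1 < L \<or> i + 2 = h" using i h by auto
  then have "(\<Sum>j | (i, j) \<in> chain L \<union> (chain L)\<inverse>. s (j + 1)) = s i + s (i + 2)"
    unfolding chain_neighbour_sum[OF i] using ends i h by (auto simp: numeral_2_eq_2)
  also have "\<dots> = 2 * cos (pi / real h) * s (i + 1)"
    unfolding s_def by (rule sin_multiple_recurrence)
  finally show "(\<Sum>j | (i, j) \<in> chain L \<union> (chain L)\<inverse>. sin (real (j + 1) * (pi / real h))) =
      2 * cos (pi / real h) * sin (real (i + 1) * (pi / real h))"
    by (simp add: s_def)
qed

text \<open>The diagrams of type \<open>D\<close> and \<open>E\<close> are chains \<open>0, \<dots>, m - 1\<close> with one more vertex \<open>m\<close> attached
  at \<open>b\<close>: three arms with \<open>b\<close>, \<open>m - b - 1\<close> and \<open>1\<close> vertices meet at \<open>b\<close>.  On each arm the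
  eigenfunction is a multiple of the sines counted from the free end; the multiples are chosen as
  products of sines so that all three arms give \<open>b\<close> the same value.  Only the equation at \<open>b\<close>
  then remains, and this is the condition \<open>branch\<close> that singles out the Coxeter number.\<close>

lemma branched_chain_positive_eigenfunction:
  fixes h :: nat
  defines "s \<equiv> \<lambda>k. sin (real k * (pi / real h))"
  assumes b: "b < m" and h: "b + 1 < h" "m - b < h" "2 < h"
    and G: "pverts G = {..<m + 1}" "E = insert (b, m) (chain m)" "parcs G = E \<union> E\<inverse>"
    and branch: "s b * s 2 * s (m - b) + s (b + 1) * s 2 * s (m - b - 1) + s 1 * s (b + 1) * s (m - b)
      = 2 * cos (pi / real h) * (s (b + 1) * s 2 * s (m - b))"
  shows "\<exists>f. positive_eigenfunction G (2 * cos (pi / real h)) f"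
proof
  define c where "c = 2 * cos (pi / real h)"
  define f where "f j = (if j = m then s 1 * s (b + 1) * s (m - b)
    else if j \<le> b then s (j + 1) * s 2 * s (m - b) else s (b + 1) * s 2 * s (m - j))" for j
  have pos: "0 < s k" if "0 < k" "k < h" for k
    unfolding s_def using that by (rule sin_multiple_pos)
  have rec: "s k + s (k + 2) = c * s (k + 1)" for k
    unfolding s_def c_def by (rule sin_multiple_recurrence)
  have s0: "s 0 = 0" by (simp add: s_def)
  have s2: "s 2 = c * s 1" using rec[of 0] s0 by (simp add: numeral_2_eq_2)
  show "positive_eigenfunction G (2 * cos (pi / real h)) f"
    unfolding positive_eigenfunction_def G(1,3) c_def[symmetric]
  proof (intro ballI conjI)
    fix i assume "i \<in> {..<m + 1}"
    then have i: "i \<le> m" by simp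
    let ?N = "(if i = m then f b else (if i = 0 then 0 else f (i - 1)) +
      (if i + 1 < m then f (i + 1) else 0) + (if i = b then f m else 0))"
    show "0 < f i" unfolding f_def using b h i by (auto intro!: mult_pos_pos pos)
    consider "i = m" | "i < b" | "i = b" | "b < i" "i < m" using i by linarith
    then show "(\<Sum>j | (i, j) \<in> E \<union> E\<inverse>. f j) = c * f i"
      unfolding branched_chain_neighbour_sum[OF b i G(2)]
    proof cases
      case 1
      then show "?N = c * f i"
        using b by (simp add: f_def s2)
    next
      case 2
      then have "(if i = 0 then 0 else f (i - 1)) = s i * s 2 * s (m - b)" 
          "f (i + 1) = s (i + 2) * s 2 * s (m - b)" "f i = s (i + 1) * s 2 * s (m - b)"
        using b s0 by (auto simp: f_def)
      with 2 show "?N = c * f i"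
        using b rec[of i] by (simp add: distrib_right[symmetric])
    next
      case 3
      have "(if i = 0 then 0 else f (i - 1)) = s b * s 2 * s (m - b)"
        using 3 b s0 by (auto simp: f_def)
      moreover have "(if i + 1 < m then f (i + 1) else 0) = s (b + 1) * s 2 * s (m - b - 1)"
      proof (cases "i + 1 < m")
        case False
        then have "m - b - 1 = 0" using 3 by simp
        then show ?thesis using False s0 by simp
      qed (use 3 in \<open>simp add: f_def\<close>)
      moreover have "f m = s 1 * s (b + 1) * s (m - b)" "f b = s (b + 1) * s 2 * s (m - b)"
        using b by (simp_all add: f_def)
      ultimately show "?N = c * f i"
        using 3 b branch by (simp add: c_def)
    next
      case 4
      obtain k where k: "m = i + k + 1" using 4 less_imp_add_positive[of i m]
        by (metis less_natE add.commute add_Suc_right Suc_eq_plus1)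
      have "(if i = 0 then 0 else f (i - 1)) = s (b + 1) * s 2 * s (k + 2)"
      proof (cases "i = b + 1")
        case True
        then show ?thesis using k by (simp add: f_def)
      next
        case False
        then have "m - (i - 1) = k + 2" "\<not> i - 1 \<le> b" "i - 1 \<noteq> m" "i \<noteq> 0" using k 4 by auto
        then show ?thesis by (simp only: f_def if_False)
      qed
      moreover have "(if i + 1 < m then f (i + 1) else 0) = s (b + 1) * s 2 * s k"
        using 4 k s0 by (auto simp: f_def)
      moreover have "f i = s (b + 1) * s 2 * s (k + 1)" using 4 k by (simp add: f_def)
      moreover have "s (b + 1) * s 2 * s (k + 2) + s (b + 1) * s 2 * s k
          = c * (s (b + 1) * s 2 * s (k + 1))"
        using rec[of k] by Groebner_Basis.algebra
      ultimately show "?N = c * f i"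
        using 4 by simp
    qed
  qed
qed

text \<open>Here \<open>(L - 1) \<theta> = \<pi> / 2\<close>, so the sine of \<open>(L - 2) \<theta>\<close> is \<open>cos \<theta>\<close> and the two short arms of
  length one balance the recurrence of the long arm.\<close>

lemma type_D_branch_equation:
  fixes L :: nat
  defines "s \<equiv> \<lambda>k. sin (real k * (pi / real (2 * L - 2)))"
  assumes L: "4 \<le> L"
  shows "s (L - 3) * s 2 * s 2 + s (L - 2) * s 2 * s 1 + s 1 * s (L - 2) * s 2
    = 2 * cos (pi / real (2 * L - 2)) * (s (L - 2) * s 2 * s 2)"
proof -
  define \<theta> where "\<theta> = pi / real (2 * L - 2)"
  have q: "real (L - 1) * \<theta> = pi / 2" using L by (simp add: \<theta>_def of_nat_diff field_simps)
  have "s (L - 1) = 1" unfolding s_def \<theta>_def[symmetric] q by simp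
  have "real (L - 2) * \<theta> = pi / 2 - \<theta>" using q L by (simp add: of_nat_diff algebra_simps)
  then have a: "s (L - 2) = cos \<theta>" by (simp add: s_def flip: \<theta>_def) (simp add: cos_sin_eq)
  have "L - 3 + 2 = L - 1" "L - 3 + 1 = L - 2" using L by auto
  then have r: "s (L - 3) + 1 = 2 * cos \<theta> * cos \<theta>"
    using sin_multiple_recurrence[of "L - 3" \<theta>] a \<open>s (L - 1) = 1\<close> by (simp add: s_def \<theta>_def)
  have "s 2 = 2 * cos \<theta> * s 1"
    using sin_multiple_recurrence[of 0 \<theta>] by (simp add: s_def \<theta>_def)
  then show ?thesis unfolding a \<theta>_def[symmetric] using r by Groebner_Basis.algebra
qed

lemma cos_multiples:
  fixes x :: real
  defines "c \<equiv> 2 * cos x"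
  shows "2 * cos (2 * x) = c ^ 2 - 2"
    and "2 * cos (6 * x) = c ^ 6 - 6 * c ^ 4 + 9 * c ^ 2 - 2"
    and "2 * cos (10 * x) = c ^ 10 - 10 * c ^ 8 + 35 * c ^ 6 - 50 * c ^ 4 + 25 * c ^ 2 - 2"
proof -
  have d: "2 * cos (2 * y) = (2 * cos y) ^ 2 - 2" for y :: real
    using cos_double_cos[of y] by (simp add: power2_eq_square)
  show two: "2 * cos (2 * x) = c ^ 2 - 2" unfolding c_def by (rule d)
  have three: "2 * cos (3 * x) = c ^ 3 - 3 * c"
    using cos_treble_cos[of x] by (simp add: c_def power3_eq_cube)
  have "cos (5 * x) + cos x = 2 * cos (3 * x) * cos (2 * x)"
    using cos_add[of "3 * x" "2 * x"] cos_diff[of "3 * x" "2 * x"] by simp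
  then have five: "2 * cos (5 * x) = c ^ 5 - 5 * c ^ 3 + 5 * c"
    using two three unfolding c_def by Groebner_Basis.algebra
  show "2 * cos (6 * x) = c ^ 6 - 6 * c ^ 4 + 9 * c ^ 2 - 2"
  proof -
    have "2 * cos (6 * x) = (2 * cos (3 * x)) ^ 2 - 2" using d[of "3 * x"] by simp
    then show ?thesis using three by Groebner_Basis.algebra
  qed
  show "2 * cos (10 * x) = c ^ 10 - 10 * c ^ 8 + 35 * c ^ 6 - 50 * c ^ 4 + 25 * c ^ 2 - 2"
  proof -
    have "2 * cos (10 * x) = (2 * cos (5 * x)) ^ 2 - 2" using d[of "5 * x"] by simp
    then show ?thesis using five by Groebner_Basis.algebra
  qed
qed

text \<open>The numbers \<open>2 cos (\<pi> / 12)\<close>, \<open>2 cos (\<pi> / 18)\<close>, \<open>2 cos (\<pi> / 30)\<close> are roots of the three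
  polynomials to which the equation at the branch vertex reduces for \<open>E\<^sub>6\<close>, \<open>E\<^sub>7\<close>, \<open>E\<^sub>8\<close>.  Each comes
  from a multiple of the angle at which the cosine is known.\<close>

lemma coxeter_polynomial_E6: "(2 * cos (pi / 12)) ^ 4 - 4 * (2 * cos (pi / 12)) ^ 2 + 1 = (0::real)"
proof -
  define c :: real where "c = 2 * cos (pi / 12)"
  have "c ^ 2 - 2 = sqrt 3"
    using cos_multiples(1)[of "pi / 12"] cos_30 by (simp add: c_def)
  then have "(c ^ 2 - 2) ^ 2 = 3" by simp
  moreover have "(c ^ 2 - 2) ^ 2 = c ^ 4 - 4 * c ^ 2 + 4" by Groebner_Basis.algebra
  ultimately show ?thesis unfolding c_def[symmetric] by simp
qed

lemma coxeter_polynomial_E7: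
  "(2 * cos (pi / 18)) ^ 6 - 6 * (2 * cos (pi / 18)) ^ 4 + 9 * (2 * cos (pi / 18)) ^ 2 - 3 = (0::real)"
  using cos_multiples(2)[of "pi / 18"] cos_60 by simp

lemma coxeter_polynomial_E8:
  "(2 * cos (pi / 30)) ^ 8 - 7 * (2 * cos (pi / 30)) ^ 6 + 14 * (2 * cos (pi / 30)) ^ 4
    - 8 * (2 * cos (pi / 30)) ^ 2 + 1 = (0::real)"
proof -
  define c :: real where "c = 2 * cos (pi / 30)"
  have "c ^ 10 - 10 * c ^ 8 + 35 * c ^ 6 - 50 * c ^ 4 + 25 * c ^ 2 - 2 = 1"
    using cos_multiples(3)[of "pi / 30"] cos_60 by (simp add: c_def)
  \<comment> \<open>The factor \<open>c\<^sup>2 - 3\<close> belongs to the angle \<open>\<pi> / 6\<close>, whose tenfold multiple has the same cosine.\<close>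
  then have "(c ^ 2 - 3) * (c ^ 8 - 7 * c ^ 6 + 14 * c ^ 4 - 8 * c ^ 2 + 1) = 0" by Groebner_Basis.algebra
  moreover have "c ^ 2 - 3 \<noteq> 0"
  proof -
    have "cos (pi / 3) < cos (2 * (pi / 30))" by (rule cos_monotone_0_pi) auto
    then show ?thesis using cos_multiples(1)[of "pi / 30"] cos_60 by (simp add: c_def)
  qed
  ultimately show ?thesis by (simp add: c_def)
qed

lemma sin_multiples:
  fixes x :: real
  defines "c \<equiv> 2 * cos x"
  shows "sin (2 * x) = c * sin x" "sin (3 * x) = (c ^ 2 - 1) * sin x"
    "sin (4 * x) = (c ^ 3 - 2 * c) * sin x" "sin (5 * x) = (c ^ 4 - 3 * c ^ 2 + 1) * sin x"
proof -
  note r = sin_multiple_recurrence[of _ x, folded c_def]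
  show 2: "sin (2 * x) = c * sin x" using r[of 0] by simp
  show 3: "sin (3 * x) = (c ^ 2 - 1) * sin x" using r[of 1] 2 by simp Groebner_Basis.algebra
  show 4: "sin (4 * x) = (c ^ 3 - 2 * c) * sin x" using r[of 2] 2 3 by simp Groebner_Basis.algebra
  show "sin (5 * x) = (c ^ 4 - 3 * c ^ 2 + 1) * sin x" using r[of 3] 3 4 by simp Groebner_Basis.algebra
qed

lemma E_branch_equations:
  fixes x :: real
  defines "c \<equiv> 2 * cos x" and "s \<equiv> \<lambda>k::nat. sin (real k * x)"
  shows "c ^ 4 - 4 * c ^ 2 + 1 = 0 \<Longrightarrow>
      s 2 * s 2 * s 3 + s 3 * s 2 * s 2 + s 1 * s 3 * s 3 = c * (s 3 * s 2 * s 3)"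
    and "c ^ 6 - 6 * c ^ 4 + 9 * c ^ 2 - 3 = 0 \<Longrightarrow>
      s 2 * s 2 * s 4 + s 3 * s 2 * s 3 + s 1 * s 3 * s 4 = c * (s 3 * s 2 * s 4)"
    and "c ^ 8 - 7 * c ^ 6 + 14 * c ^ 4 - 8 * c ^ 2 + 1 = 0 \<Longrightarrow>
      s 2 * s 2 * s 5 + s 3 * s 2 * s 4 + s 1 * s 3 * s 5 = c * (s 3 * s 2 * s 5)"
proof -
  define u where "u = sin x"
  have s: "s 1 = u" "s 2 = c * u" "s 3 = (c ^ 2 - 1) * u"
    "s 4 = (c ^ 3 - 2 * c) * u" "s 5 = (c ^ 4 - 3 * c ^ 2 + 1) * u"
    using sin_multiples[of x] by (simp_all add: s_def c_def u_def)
  show "s 2 * s 2 * s 3 + s 3 * s 2 * s 2 + s 1 * s 3 * s 3 = c * (s 3 * s 2 * s 3)"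
    if "c ^ 4 - 4 * c ^ 2 + 1 = 0" using that unfolding s by Groebner_Basis.algebra
  show "s 2 * s 2 * s 4 + s 3 * s 2 * s 3 + s 1 * s 3 * s 4 = c * (s 3 * s 2 * s 4)"
    if "c ^ 6 - 6 * c ^ 4 + 9 * c ^ 2 - 3 = 0" using that unfolding s by Groebner_Basis.algebra
  show "s 2 * s 2 * s 5 + s 3 * s 2 * s 4 + s 1 * s 3 * s 5 = c * (s 3 * s 2 * s 5)"
    if "c ^ 8 - 7 * c ^ 6 + 14 * c ^ 4 - 8 * c ^ 2 + 1 = 0" using that unfolding s by Groebner_Basis.algebra
qed

lemma dynkin_positive_eigenfunction:
  assumes "is_dynkin X"
  shows "\<exists>f. positive_eigenfunction (dynkin_graph X) (2 * cos (pi / real (coxeter_number X))) f"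
proof (cases X)
  case (type_A L)
  then show ?thesis
    using chain_positive_eigenfunction[OF refl, of "dynkin_graph X" L]
    by (auto simp: dynkin_graph_def)
next
  case (type_D L)
  with assms have L: "4 \<le> L" by simp
  have "\<exists>f. positive_eigenfunction (dynkin_graph (type_D L)) (2 * cos (pi / real (2 * L - 2))) f"
  proof (rule branched_chain_positive_eigenfunction[where b = "L - 3" and m = "L - 1"])
    show "parcs (dynkin_graph (type_D L)) =
        insert (L - 3, L - 1) (chain (L - 1)) \<union> (insert (L - 3, L - 1) (chain (L - 1)))\<inverse>"
      by (simp add: dynkin_graph_def)
    have idx: "L - 1 - (L - 3) = 2" "L - 3 + 1 = L - 2" "2 - 1 = (1::nat)" using L by auto
    show "sin (real (L - 3) * (pi / real (2 * L - 2))) * sin (real 2 * (pi / real (2 * L - 2))) *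
        sin (real (L - 1 - (L - 3)) * (pi / real (2 * L - 2))) +
      sin (real (L - 3 + 1) * (pi / real (2 * L - 2))) * sin (real 2 * (pi / real (2 * L - 2))) *
        sin (real (L - 1 - (L - 3) - 1) * (pi / real (2 * L - 2))) +
      sin (real 1 * (pi / real (2 * L - 2))) * sin (real (L - 3 + 1) * (pi / real (2 * L - 2))) *
        sin (real (L - 1 - (L - 3)) * (pi / real (2 * L - 2))) =
      2 * cos (pi / real (2 * L - 2)) *
        (sin (real (L - 3 + 1) * (pi / real (2 * L - 2))) * sin (real 2 * (pi / real (2 * L - 2))) *
          sin (real (L - 1 - (L - 3)) * (pi / real (2 * L - 2))))"
      unfolding idx by (rule type_D_branch_equation[OF L])
  qed (use L in \<open>auto simp: dynkin_graph_def\<close>)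
  then show ?thesis by (simp add: type_D)
next
  case type_E6
  then show ?thesis
    using branched_chain_positive_eigenfunction[where b = 2 and m = 5 and h = 12
        and G = "dynkin_graph type_E6", OF _ _ _ _ _ refl]
      E_branch_equations(1)[of "pi / 12"] coxeter_polynomial_E6
    by (simp add: dynkin_graph_def)
next
  case type_E7
  then show ?thesis
    using branched_chain_positive_eigenfunction[where b = 2 and m = 6 and h = 18
        and G = "dynkin_graph type_E7", OF _ _ _ _ _ refl]
      E_branch_equations(2)[of "pi / 18"] coxeter_polynomial_E7
    by (simp add: dynkin_graph_def)
next
  case type_E8
  then show ?thesis
    using branched_chain_positive_eigenfunction[where b = 2 and m = 7 and h = 30
        and G = "dynkin_graph type_E8", OF _ _ _ _ _ refl]
      E_branch_equations(3)[of "pi / 30"] coxeter_polynomial_E8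
    by (simp add: dynkin_graph_def)
qed

section \<open>The parametrization by sines\<close>

text \<open>Over the common denominator the numerators of \<open>f z' - f z\<close> and of \<open>D\<close> are
  \<open>sin \<lambda> sin (z' - z)\<close> and \<open>sin \<lambda> sin (\<lambda> - (z' - z))\<close>, by the addition theorems.\<close>

lemma f_param_difference:
  fixes z z' :: complex
  assumes "sin (complex_of_real lam) \<noteq> 0"
    and "sin (complex_of_real lam - z) \<noteq> 0" "sin (complex_of_real lam - z') \<noteq> 0"
      "sin (complex_of_real lam - (z' - z)) \<noteq> 0"
  defines "D \<equiv> 1 + 2 * cos (complex_of_real lam) * f_param lam z + f_param lam z * f_param lam z'"
  shows "D \<noteq> 0" and "f_param lam (z' - z) = (f_param lam z' - f_param lam z) / D"
proof -
  define l where "l = complex_of_real lam"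
  have nz: "sin l \<noteq> 0" "sin (l - z) \<noteq> 0" "sin (l - z') \<noteq> 0" "sin (l - (z' - z)) \<noteq> 0"
    using assms by (simp_all add: l_def)
  have py: "sin x ^ 2 = 1 - cos x ^ 2" for x :: complex by (simp add: sin_squared_eq)
  have num: "sin z' * sin (l - z) - sin z * sin (l - z') = sin l * sin (z' - z)"
    unfolding sin_diff by (simp add: algebra_simps)
  have den: "sin (l - z) * sin (l - z') + 2 * cos l * sin z * sin (l - z') + sin z * sin z'
      = sin l * sin (l - (z' - z))"
    unfolding sin_diff cos_diff using py[of l] py[of z] py[of z'] by Groebner_Basis.algebra
  have D: "D = sin l * sin (l - (z' - z)) / (sin (l - z) * sin (l - z'))"
    unfolding D_def f_param_def l_def[symmetric] den[symmetric] using nz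
    by (simp add: field_simps)
  then show "D \<noteq> 0" using nz by simp
  have "f_param lam z' - f_param lam z = sin l * sin (z' - z) / (sin (l - z) * sin (l - z'))"
    unfolding f_param_def l_def[symmetric] num[symmetric] using nz by (simp add: field_simps)
  then show "f_param lam (z' - z) = (f_param lam z' - f_param lam z) / D"
    unfolding D using nz by (simp add: f_param_def flip: l_def)
qed

section \<open>Temperley--Lieb relations and the Yang--Baxter equation\<close>

text \<open>Expanding both sides and reducing with the Temperley--Lieb relations leaves combinations of
  \<open>v\<close>, \<open>E v\<close>, \<open>F v\<close>, \<open>E (F v)\<close>, \<open>F (E v)\<close>.  They agree precisely by the relation \<open>pqr\<close> between
  the parameters, which is that of \<open>f (z - w)\<close>, \<open>f z\<close>, \<open>f w\<close>.  The relations enter only at the one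
  vector \<open>v\<close>, so that they may be established on a single source fiber.\<close>

lemma yang_baxter_of_temperley_lieb:
  fixes E F :: "('b \<Rightarrow>\<^sub>0 complex) \<Rightarrow> ('b \<Rightarrow>\<^sub>0 complex)"
  assumes E: "Vector_Spaces.linear vscale vscale E" and F: "Vector_Spaces.linear vscale vscale F"
    and EE: "E (E v) = vscale \<kappa> (E v)" and FF: "F (F v) = vscale \<kappa> (F v)"
    and EFE: "E (F (E v)) = E v" and FEF: "F (E (F v)) = F v"
    and pqr: "p * (1 + \<kappa> * r + r * q) = q - r"
  defines "A \<equiv> \<lambda>t u. u + vscale t (E u)" and "B \<equiv> \<lambda>t u. u + vscale t (F u)"
  shows "B p (A q (B r v)) = A r (B q (A p v))"
proof -
  interpret E: Vector_Spaces.linear vscale vscale E by fact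
  interpret F: Vector_Spaces.linear vscale vscale F by fact
  have r: "p + r + p * r * \<kappa> + p * q * r = q" using pqr by Groebner_Basis.algebra
  show ?thesis
  proof (rule poly_mapping_eqI)
    fix k
    define e f ef fe where "e = Poly_Mapping.lookup (E v) k" and "f = Poly_Mapping.lookup (F v) k"
      and "ef = Poly_Mapping.lookup (E (F v)) k" and "fe = Poly_Mapping.lookup (F (E v)) k"
    have "Poly_Mapping.lookup (B p (A q (B r v))) k = Poly_Mapping.lookup v k
        + (p + r + p * r * \<kappa> + p * q * r) * f + q * e + p * q * fe + q * r * ef"
      by (simp add: A_def B_def E.add E.scale F.add F.scale FF FEF lookup_add e_def f_def ef_def
          fe_def algebra_simps)
    moreover have "Poly_Mapping.lookup (A r (B q (A p v))) k = Poly_Mapping.lookup v k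
        + (p + r + p * r * \<kappa> + p * q * r) * e + q * f + p * q * fe + q * r * ef"
      by (simp add: A_def B_def E.add E.scale F.add F.scale EE EFE lookup_add e_def f_def ef_def
          fe_def algebra_simps)
    ultimately show "Poly_Mapping.lookup (B p (A q (B r v))) k = Poly_Mapping.lookup (A r (B q (A p v))) k"
      unfolding r by simp
  qed
qed

section \<open>The operators on paths of length three\<close>

lemma lin_ext_id_plus_scale:
  "lin_ext (\<lambda>b. bvec b + vscale c (g b)) v = v + vscale c (lin_ext g v)"
proof -
  have "lin_ext (\<lambda>b. bvec b + vscale c (g b)) v = lin_ext bvec v + vscale c (lin_ext g v)"
    by (simp add: lin_ext_def free_vs.scale_right_distrib sum.distrib free_vs.scale_sum_right mult.commute)
  then show ?thesis by (simp add: lin_ext_bvec_id)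
qed

lemma vassoc_vtensor_left_linear: "Vector_Spaces.linear vscale vscale (\<lambda>u. vassoc (u \<otimes>\<^sub>v t))"
  unfolding vtensor_def vassoc_def linear_lin_ext[OF lin_ext_linear] by (rule lin_ext_linear)

lemma vassoc_bvec: "vassoc (bvec ((x, y), t)) = bvec (x, y, t)"
  by (simp add: vassoc_def lin_ext_bvec)

lemma op12_R_check:
  "op12 (R_check G S lam z) a v = v + vscale (f_param lam z) (op12 (T_op G S) a v)"
proof -
  have "vassoc (R_check G S lam z a (bvec x \<otimes>\<^sub>v bvec y) \<otimes>\<^sub>v bvec t) = bvec (x, y, t)
      + vscale (f_param lam z) (vassoc (T_op G S a (bvec x \<otimes>\<^sub>v bvec y) \<otimes>\<^sub>v bvec t))"
    for x y t :: "nat \<times> nat"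
  proof -
    interpret L: Vector_Spaces.linear vscale vscale
      "\<lambda>u :: ((nat \<times> nat) \<times> (nat \<times> nat)) \<Rightarrow>\<^sub>0 complex. vassoc (u \<otimes>\<^sub>v bvec t)"
      by (rule vassoc_vtensor_left_linear)
    show ?thesis by (simp add: R_check_def L.add L.scale vtensor_bvec vassoc_bvec)
  qed
  then have *: "(\<lambda>(x, y, t :: nat \<times> nat). vassoc (R_check G S lam z a (bvec x \<otimes>\<^sub>v bvec y) \<otimes>\<^sub>v bvec t)) =
    (\<lambda>b. bvec b + vscale (f_param lam z)
       ((\<lambda>(x, y, t). vassoc (T_op G S a (bvec x \<otimes>\<^sub>v bvec y) \<otimes>\<^sub>v bvec t)) b))"
    by (auto simp: fun_eq_iff)
  show ?thesis unfolding op12_def * by (rule lin_ext_id_plus_scale)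
qed

lemma vtensor_right_linear: "Vector_Spaces.linear vscale vscale (\<lambda>w. u \<otimes>\<^sub>v w)"
  unfolding vtensor_def by (subst lin_ext_swap) (rule lin_ext_linear)

lemma op23_R_check:
  "op23 V (R_check G S lam z) v = v + vscale (f_param lam z) (op23 V (T_op G S) v)"
proof -
  have "bvec x \<otimes>\<^sub>v R_check G S lam z d (bvec y \<otimes>\<^sub>v bvec t) = bvec (x, y, t)
      + vscale (f_param lam z) (bvec x \<otimes>\<^sub>v T_op G S d (bvec y \<otimes>\<^sub>v bvec t))"
    for x y t :: "nat \<times> nat" and d
  proof -
    interpret vt: Vector_Spaces.linear vscale vscale
      "\<lambda>w :: ((nat \<times> nat) \<times> (nat \<times> nat)) \<Rightarrow>\<^sub>0 complex. bvec x \<otimes>\<^sub>v w"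
      by (rule vtensor_right_linear)
    show ?thesis by (simp add: R_check_def vt.add vt.scale vtensor_bvec)
  qed
  then have *: "(\<lambda>(x, y, t). bvec x \<otimes>\<^sub>v
      R_check G S lam z (gtarget (grade V x)) (bvec y \<otimes>\<^sub>v bvec t)) =
    (\<lambda>b. bvec b + vscale (f_param lam z)
       ((\<lambda>(x, y, t). bvec x \<otimes>\<^sub>v T_op G S (gtarget (grade V x)) (bvec y \<otimes>\<^sub>v bvec t)) b))"
    by (auto simp: fun_eq_iff)
  show ?thesis unfolding op23_def * by (rule lin_ext_id_plus_scale)
qed

text \<open>Paths of length three from \<open>a\<close>, each identified with the tensor of its edges, form a basis of the
  source fiber at \<open>a\<close>.  Naming the vertices only once builds in the composability of the edges.\<close>

definition path_vec :: "nat \<Rightarrow> nat \<Rightarrow> nat \<Rightarrow> nat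
    \<Rightarrow> ((nat \<times> nat) \<times> (nat \<times> nat) \<times> (nat \<times> nat) \<Rightarrow>\<^sub>0 complex)" where
  "path_vec p q r t = bvec ((p, q), (q, r), (r, t))"

definition tl_weight :: "real vec \<Rightarrow> nat \<Rightarrow> nat \<Rightarrow> nat \<Rightarrow> complex" where
  "tl_weight S d a c = complex_of_real (sqrt (S $ a * S $ c / (S $ d * S $ d)))"

lemma T_op_edges:
  "T_op G S d (bvec ((d, a), (a, b))) =
    (if b = d then \<Sum>c \<in> {c. (d, c) \<in> parcs G}. vscale (tl_weight S d a c) (bvec ((d, c), (c, d))) else 0)"
  by (simp add: T_op_def lin_ext_bvec vtensor_bvec tl_weight_def)

lemma op12_T_path:
  "op12 (T_op G S) a (path_vec a q r t) =
    (if r = a then \<Sum>c \<in> {c. (a, c) \<in> parcs G}. vscale (tl_weight S a q c) (path_vec a c a t) else 0)"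
proof -
  interpret L: Vector_Spaces.linear vscale vscale
    "\<lambda>u :: ((nat \<times> nat) \<times> (nat \<times> nat)) \<Rightarrow>\<^sub>0 complex. vassoc (u \<otimes>\<^sub>v bvec (r, t))"
    by (rule vassoc_vtensor_left_linear)
  have "op12 (T_op G S) a (path_vec a q r t) = vassoc (T_op G S a (bvec ((a, q), (q, r))) \<otimes>\<^sub>v bvec (r, t))"
    by (simp add: op12_def path_vec_def lin_ext_bvec vtensor_bvec)
  also have "\<dots> = (if r = a then \<Sum>c \<in> {c. (a, c) \<in> parcs G}.
      vscale (tl_weight S a q c) (vassoc (bvec ((a, c), (c, a)) \<otimes>\<^sub>v bvec (r, t))) else 0)"
    unfolding T_op_edges if_distrib[of "\<lambda>u. vassoc (u \<otimes>\<^sub>v bvec (r, t))"] L.sum L.scale L.zero ..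
  finally show ?thesis by (simp add: vtensor_bvec vassoc_bvec path_vec_def)
qed

lemma edge_walk:
  assumes "pair_graph G" "(x, y) \<in> parcs G"
  shows "vwalk [x, y] (with_proj G)"
proof -
  interpret pair_graph G by fact
  show ?thesis using assms(2) in_arcsD1[OF assms(2)] in_arcsD2[OF assms(2)] by (simp add: vwalk_def)
qed

lemma edge_arrow_ends:
  assumes "pair_graph G" "(x, y) \<in> parcs G"
  shows "gsource (edge_arrow G (x, y)) = x" "gtarget (edge_arrow G (x, y)) = y"
  using gsource_walk_arrow[OF edge_walk[OF assms]] gtarget_walk_arrow[OF edge_walk[OF assms]]
  by (simp_all add: edge_arrow_def)

lemma op23_T_path:
  assumes "pair_graph G" "(p, q) \<in> parcs G"
  shows "op23 (edge_space G) (T_op G S) (path_vec p q r t) =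
    (if t = q then \<Sum>c \<in> {c. (q, c) \<in> parcs G}. vscale (tl_weight S q r c) (path_vec p q c q) else 0)"
proof -
  interpret vt: Vector_Spaces.linear vscale vscale
    "\<lambda>w :: ((nat \<times> nat) \<times> (nat \<times> nat)) \<Rightarrow>\<^sub>0 complex. bvec (p, q) \<otimes>\<^sub>v w"
    by (rule vtensor_right_linear)
  have "gtarget (grade (edge_space G) (p, q)) = q"
    using edge_arrow_ends(2)[OF assms] by (simp add: edge_space_def)
  then show ?thesis
    by (simp add: op23_def path_vec_def lin_ext_bvec vtensor_bvec T_op_edges vt.sum vt.scale vt.zero)
qed

text \<open>The Temperley--Lieb relations hold for every positive eigenfunction on every graph: positivity
  makes the square roots multiplicative, and the eigenvalue equation supplies the loop value \<open>\<kappa>\<close>.\<close>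

locale weighted_graph = pair_graph G for G :: "nat pair_pre_digraph" +
  fixes S :: "real vec" and \<kappa> :: real
  assumes S_pos: "d \<in> pverts G \<Longrightarrow> 0 < S $ d"
    and S_eigen: "d \<in> pverts G \<Longrightarrow> (\<Sum>c | (d, c) \<in> parcs G. S $ c) = \<kappa> * S $ d"
begin

abbreviation "nbrs d \<equiv> {c. (d, c) \<in> parcs G}"
abbreviation "E \<equiv> op12 (T_op G S)"
abbreviation "F \<equiv> op23 (edge_space G) (T_op G S)"
abbreviation "w \<equiv> tl_weight S"

lemma E_linear: "Vector_Spaces.linear vscale vscale (E a)"
  unfolding op12_def by (rule lin_ext_linear)

lemma F_linear: "Vector_Spaces.linear vscale vscale F"
  unfolding op23_def by (rule lin_ext_linear)

lemma finite_nbrs: "finite (nbrs d)"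
  using finite_arcs by (rule finite_surj[of _ _ snd]) force

lemma arc_verts: "(x, y) \<in> parcs G \<Longrightarrow> x \<in> pverts G" "(x, y) \<in> parcs G \<Longrightarrow> y \<in> pverts G"
  using in_arcsD1 in_arcsD2 by auto

lemma arc_sym: "(x, y) \<in> parcs G \<Longrightarrow> (y, x) \<in> parcs G"
  using arcs_symmetric by blast

lemma tl_weight_eq:
  assumes "d \<in> pverts G"
  shows "w d a c = complex_of_real (sqrt (S $ a) * sqrt (S $ c) / S $ d)"
  using S_pos[OF assms] by (simp add: tl_weight_def real_sqrt_divide real_sqrt_mult)

text \<open>The weights form a matrix of rank one at each vertex \<open>d\<close>, with vector \<open>\<surd>(S c)\<close> up to the factor
  \<open>1 / S d\<close>; its trace is \<open>\<kappa>\<close> by the eigenvalue equation.\<close>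

lemma tl_weight_square:
  assumes d: "d \<in> pverts G"
  shows "(\<Sum>c \<in> nbrs d. w d a c * w d c c') = complex_of_real \<kappa> * w d a c'"
proof -
  have "w d a c * w d c c' = complex_of_real (sqrt (S $ a) * sqrt (S $ c') / (S $ d)\<^sup>2 * S $ c)"
    if "c \<in> nbrs d" for c
  proof -
    have "0 \<le> S $ c" using S_pos arc_verts(2) that by (auto intro: less_imp_le)
    then have "sqrt (S $ c) * sqrt (S $ c) = S $ c" by simp
    then have "sqrt (S $ a) * sqrt (S $ c) / S $ d * (sqrt (S $ c) * sqrt (S $ c') / S $ d)
        = sqrt (S $ a) * sqrt (S $ c') / (S $ d)\<^sup>2 * S $ c"
      by (simp add: power2_eq_square field_simps)
    then show ?thesis by (simp only: tl_weight_eq[OF d] of_real_mult[symmetric])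
  qed
  then have "(\<Sum>c \<in> nbrs d. w d a c * w d c c') =
      complex_of_real (sqrt (S $ a) * sqrt (S $ c') / (S $ d)\<^sup>2 * (\<Sum>c \<in> nbrs d. S $ c))"
    by (simp add: sum_distrib_left)
  also have "\<dots> = complex_of_real \<kappa> * w d a c'"
    unfolding S_eigen[OF d] tl_weight_eq[OF d] using S_pos[OF d]
    by (simp add: power2_eq_square)
  finally show ?thesis .
qed

text \<open>In a triple product the factors \<open>S d\<close> and \<open>S y\<close> produced by the middle operator cancel those
  of the outer two, whence \<open>E F E = E\<close> and \<open>F E F = F\<close> without a scalar.\<close>

lemma tl_weight_triple:
  assumes "d \<in> pverts G" "y \<in> pverts G"
  shows "w d x y * (w y d d * w d y c) = w d x c"
  using S_pos[OF assms(1)] S_pos[OF assms(2)]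
  unfolding tl_weight_eq[OF assms(1)] tl_weight_eq[OF assms(2)]
  by (simp add: field_simps flip: of_real_mult)

text \<open>On paths with a fixed outer part, \<open>E\<close> and \<open>F\<close> both act as the weight matrix at one vertex.  This
  covers the quadratic relation of both.\<close>

lemma projection_square:
  fixes b :: "nat \<Rightarrow> ('b \<Rightarrow>\<^sub>0 complex)"
  assumes L: "Vector_Spaces.linear vscale vscale L" and d: "d \<in> pverts G"
    and b: "\<And>c. c \<in> nbrs d \<Longrightarrow> L (b c) = (\<Sum>c' \<in> nbrs d. vscale (w d c c') (b c'))"
  shows "L (\<Sum>c \<in> nbrs d. vscale (w d a c) (b c))
    = vscale (complex_of_real \<kappa>) (\<Sum>c \<in> nbrs d. vscale (w d a c) (b c))"
proof -
  interpret L: Vector_Spaces.linear vscale vscale L by fact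
  have "L (\<Sum>c \<in> nbrs d. vscale (w d a c) (b c))
      = (\<Sum>c \<in> nbrs d. \<Sum>c' \<in> nbrs d. vscale (w d a c * w d c c') (b c'))"
    by (simp add: L.sum L.scale b free_vs.scale_sum_right)
  also have "\<dots> = (\<Sum>c' \<in> nbrs d. vscale (\<Sum>c \<in> nbrs d. w d a c * w d c c') (b c'))"
    by (subst sum.swap) (simp add: free_vs.scale_sum_left)
  finally show ?thesis by (simp add: tl_weight_square[OF d] free_vs.scale_sum_right)
qed

text \<open>After \<open>E\<close>, the operator \<open>F\<close> sees only the one summand that backtracks at the end of the path,
  and vice versa.\<close>

lemma linear_sum_single:
  fixes b :: "nat \<Rightarrow> ('b \<Rightarrow>\<^sub>0 complex)"
  assumes L: "Vector_Spaces.linear vscale vscale L" and y: "y \<in> nbrs d"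
    and b: "\<And>c. c \<in> nbrs d \<Longrightarrow> L (b c) = (if c = y then u else 0)"
  shows "L (\<Sum>c \<in> nbrs d. vscale (k c) (b c)) = vscale (k y) u"
proof -
  interpret L: Vector_Spaces.linear vscale vscale L by fact
  have "L (\<Sum>c \<in> nbrs d. vscale (k c) (b c)) = (\<Sum>c \<in> nbrs d. if c = y then vscale (k c) u else 0)"
    by (auto simp: L.sum L.scale b intro!: sum.cong)
  then show ?thesis using y finite_nbrs by simp
qed

lemma temperley_lieb_path:
  assumes aq: "(a, q) \<in> parcs G" and qr: "(q, r) \<in> parcs G" and rt: "(r, t) \<in> parcs G"
  defines "v \<equiv> path_vec a q r t"
  shows "E a (E a v) = vscale (complex_of_real \<kappa>) (E a v)"
    and "F (F v) = vscale (complex_of_real \<kappa>) (F v)"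
    and "E a (F (E a v)) = E a v"
    and "F (E a (F v)) = F v"
proof -
  interpret E: Vector_Spaces.linear vscale vscale "E a" by (rule E_linear)
  interpret F: Vector_Spaces.linear vscale vscale F by (rule F_linear)
  note E = op12_T_path[of G S] and F = op23_T_path[OF pair_graph_axioms, of _ _ S]
  have a: "a \<in> pverts G" and q: "q \<in> pverts G"
    using arc_verts aq by auto
  have Ev: "E a v = (if r = a then \<Sum>c \<in> nbrs a. vscale (w a q c) (path_vec a c a t) else 0)"
    unfolding v_def by (rule E)
  have Fv: "F v = (if t = q then \<Sum>c \<in> nbrs q. vscale (w q r c) (path_vec a q c q) else 0)"
    unfolding v_def by (rule F[OF aq])
  show "E a (E a v) = vscale (complex_of_real \<kappa>) (E a v)"
    unfolding Ev using projection_square[OF E_linear a, of a "\<lambda>c. path_vec a c a t"] E E.zero by simp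
  show "F (F v) = vscale (complex_of_real \<kappa>) (F v)"
    unfolding Fv using projection_square[OF F_linear q, of "\<lambda>c. path_vec a q c q"] F[OF aq] F.zero by simp
  show "E a (F (E a v)) = E a v"
  proof (cases "r = a")
    case True
    have t: "t \<in> nbrs a" "a \<in> nbrs t" "t \<in> pverts G" using rt True arc_sym arc_verts by auto
    have FE: "F (E a v) = vscale (w a q t) (\<Sum>c \<in> nbrs t. vscale (w t a c) (path_vec a t c t))"
      unfolding Ev using True F t(1) by (simp, intro linear_sum_single[OF F_linear]) auto
    have EX: "E a (\<Sum>c \<in> nbrs t. vscale (w t a c) (path_vec a t c t))
        = vscale (w t a a) (\<Sum>c \<in> nbrs a. vscale (w a t c) (path_vec a c a t))"
      using E t(2) by (intro linear_sum_single[OF E_linear]) auto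
    have "E a (F (E a v)) = (\<Sum>c \<in> nbrs a. vscale (w a q c) (path_vec a c a t))"
      unfolding FE E.scale EX by (simp add: free_vs.scale_sum_right tl_weight_triple[OF a t(3)])
    then show ?thesis using True Ev by simp
  qed (simp add: Ev F.zero E.zero)
  show "F (E a (F v)) = F v"
  proof (cases "t = q")
    case True
    have "a \<in> nbrs q" using aq arc_sym by simp
    then have EF: "E a (F v) = vscale (w q r a) (\<Sum>c \<in> nbrs a. vscale (w a q c) (path_vec a c a q))"
      unfolding Fv using True E by (simp, intro linear_sum_single[OF E_linear]) auto
    have FX: "F (\<Sum>c \<in> nbrs a. vscale (w a q c) (path_vec a c a q))
        = vscale (w a q q) (\<Sum>c \<in> nbrs q. vscale (w q a c) (path_vec a q c q))"
      using F aq by (intro linear_sum_single[OF F_linear]) auto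
    have "F (E a (F v)) = (\<Sum>c \<in> nbrs q. vscale (w q r c) (path_vec a q c q))"
      unfolding EF F.scale FX by (simp add: free_vs.scale_sum_right tl_weight_triple[OF q a])
    then show ?thesis using True Fv by simp
  qed (simp add: Fv F.zero E.zero)
qed

text \<open>A basis vector of the triple tensor product consists of composable edges, and its grade is the
  class of the resulting walk; the source of the grade is hence the first vertex of that walk.\<close>

lemma source_fiber_paths:
  defines "V \<equiv> edge_space G"
  shows "source_fiber G (gtensor G V (gtensor G V V)) a \<subseteq> free_vs.span
    {path_vec a q r t | q r t. (a, q) \<in> parcs G \<and> (q, r) \<in> parcs G \<and> (r, t) \<in> parcs G}"
    (is "_ \<subseteq> free_vs.span ?P")
  unfolding source_fiber_def
proof (rule free_vs.span_minimal[OF _ free_vs.subspace_span],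
    rule subsetI, elim UN_E CollectE conjE)
  let ?W = "gtensor G V (gtensor G V V)"
  fix v \<alpha> assume a: "gsource \<alpha> = a" and v: "v \<in> component ?W \<alpha>"
  note wk = edge_walk[OF pair_graph_axioms] and ends = edge_arrow_ends[OF pair_graph_axioms]
  have basis: "bvec b \<in> ?P" if b: "b \<in> hbasis ?W" "grade ?W b = \<alpha>" for b
  proof -
    obtain x1 x2 y1 y2 z1 z2 where bb: "b = ((x1, x2), (y1, y2), (z1, z2))"
      by (metis surj_pair)
    have e: "(x1, x2) \<in> parcs G" "(y1, y2) \<in> parcs G" "(z1, z2) \<in> parcs G"
      using b(1) by (auto simp: bb gtensor_def V_def edge_space_def)
    have yz: "y2 = z1"
      using b(1) ends(2)[OF e(2)] ends(1)[OF e(3)]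
      by (simp add: bb gtensor_def V_def edge_space_def)
    have w2: "vwalk [y1, y2, z2] (with_proj G)"
      using vwalk_join_walk[OF wk[OF e(2)] wk[OF e(3)]] yz by (simp add: vwalk_join_def)
    have c2: "gcompose G (edge_arrow G (z1, z2)) (edge_arrow G (y1, y2)) = walk_arrow G [y1, y2, z2]"
      using gcompose_walk_arrow[OF wk[OF e(2)] wk[OF e(3)]] yz
      by (simp add: edge_arrow_def vwalk_join_def)
    have xy: "x2 = y1"
      using b(1) ends(2)[OF e(1)] c2 gsource_walk_arrow[OF w2]
      by (simp add: bb gtensor_def V_def edge_space_def)
    have w3: "vwalk [x1, x2, y2, z2] (with_proj G)"
      using vwalk_join_walk[OF wk[OF e(1)] w2] xy by (simp add: vwalk_join_def)
    have "\<alpha> = walk_arrow G [x1, x2, y2, z2]"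
      using b(2) c2 gcompose_walk_arrow[OF wk[OF e(1)] w2] xy
      by (simp add: bb gtensor_def V_def edge_space_def) (simp add: edge_arrow_def vwalk_join_def)
    then have "a = x1" using a gsource_walk_arrow[OF w3] by simp
    then show ?thesis using bb e xy yz by (auto simp: path_vec_def)
  qed
  have "v = lin_ext bvec v" by (simp add: lin_ext_bvec_id)
  also have "\<dots> \<in> free_vs.span ?P"
    unfolding lin_ext_def using v basis
    by (intro free_vs.span_sum free_vs.span_scale free_vs.span_base) (auto simp: component_def)
  finally show "v \<in> free_vs.span ?P" .
qed

lemma temperley_lieb_source_fiber:
  assumes v: "v \<in> source_fiber G (gtensor G (edge_space G) (gtensor G (edge_space G) (edge_space G))) a"
  shows "E a (E a v) = vscale (complex_of_real \<kappa>) (E a v)"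
    and "F (F v) = vscale (complex_of_real \<kappa>) (F v)"
    and "E a (F (E a v)) = E a v"
    and "F (E a (F v)) = F v"
proof -
  interpret E: Vector_Spaces.linear vscale vscale "E a" by (rule E_linear)
  interpret F: Vector_Spaces.linear vscale vscale F by (rule F_linear)
  let ?tl = "{v. E a (E a v) = vscale (complex_of_real \<kappa>) (E a v) \<and>
    F (F v) = vscale (complex_of_real \<kappa>) (F v) \<and> E a (F (E a v)) = E a v \<and> F (E a (F v)) = F v}"
  have "free_vs.subspace ?tl"
    by (simp add: free_vs.subspace_def E.zero F.zero E.add F.add E.scale F.scale
        free_vs.scale_right_distrib free_vs.scale_left_commute)
  then have "source_fiber G (gtensor G (edge_space G) (gtensor G (edge_space G) (edge_space G))) a \<subseteq> ?tl"
    using temperley_lieb_path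
    by (intro order_trans[OF source_fiber_paths] free_vs.span_minimal) auto
  with v show "E a (E a v) = vscale (complex_of_real \<kappa>) (E a v)"
    and "F (F v) = vscale (complex_of_real \<kappa>) (F v)"
    and "E a (F (E a v)) = E a v"
    and "F (E a (F v)) = F v" by auto
qed

end

section \<open>The dynamical Yang--Baxter equation\<close>

theorem proposition2p33:
  fixes X :: ade and G :: "nat pair_pre_digraph" and lam :: real
  assumes "is_dynkin X"
    and "G = dynkin_graph X"
    and "parcs G \<noteq> {}"
    and "lam = pi / real (coxeter_number X)"
  shows "pf_eigenvalue G = 2 * cos lam \<and>
    (\<exists>S. pf_eigenvector G S) \<and>
    (\<forall>z z' z'' x x' x'' :: complex.
       sin (complex_of_real lam - z) \<noteq> 0 \<and> sin (complex_of_real lam - z') \<noteq> 0 \<and>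
       sin (complex_of_real lam - z'') \<noteq> 0 \<and> z'' = z' - z \<and>
       x = f_param lam z \<and> x' = f_param lam z' \<and> x'' = f_param lam z'' \<longrightarrow>
         1 + complex_of_real (pf_eigenvalue G) * x + x * x' \<noteq> 0 \<and>
         x'' = (x' - x) / (1 + complex_of_real (pf_eigenvalue G) * x + x * x')) \<and>
    (\<forall>S a. \<forall>z w :: complex.
       pf_eigenvector G S \<and> a \<in> pverts G \<and>
       sin (complex_of_real lam - z) \<noteq> 0 \<and> sin (complex_of_real lam - w) \<noteq> 0 \<and>
       sin (complex_of_real lam - (z - w)) \<noteq> 0 \<longrightarrow>
         (let V = edge_space G; R = R_check G S lam in
          \<forall>v \<in> source_fiber G (gtensor G V (gtensor G V V)) a.
            op23 V (R (z - w)) (op12 (R z) a (op23 V (R w) v)) =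
            op12 (R w) a (op23 V (R z) (op12 (R (z - w)) a v))))"
proof -
  define n where "n = dynkin_rank X"
  interpret pair_graph G using dynkin_graph_pair_graph[OF assms(1)] assms(2) by simp
  have n: "0 < n" and h: "2 \<le> coxeter_number X"
    using assms(1) by (cases X; simp add: n_def)+
  have vG: "pverts G = {..<n}" using assms(2) by (simp add: dynkin_graph_def n_def)
  have aG: "parcs G \<subseteq> {..<n} \<times> {..<n}" using in_arcsD1 in_arcsD2 vG by auto
  have sG: "sym (parcs G)" using assms(2) by (auto simp: dynkin_graph_def sym_def)
  obtain f where f: "positive_eigenfunction G (2 * cos lam) f"
    using dynkin_positive_eigenfunction[OF assms(1)] assms(2,4) by auto
  note pf = positive_eigenfunction_perron_frobenius[OF vG aG sG n f]
  have kap: "complex_of_real (pf_eigenvalue G) = 2 * cos (complex_of_real lam)"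
    by (simp add: pf(1) cos_of_real)
  have "0 < sin lam" using sin_multiple_pos[of 1 "coxeter_number X"] h assms(4) by simp
  then have lam: "sin (complex_of_real lam) \<noteq> 0" by (simp add: sin_of_real)
  have ybe: "op23 (edge_space G) (R_check G S lam (z - w)) (op12 (R_check G S lam z) a
        (op23 (edge_space G) (R_check G S lam w) v)) =
      op12 (R_check G S lam w) a (op23 (edge_space G) (R_check G S lam z)
        (op12 (R_check G S lam (z - w)) a v))"
    if S: "pf_eigenvector G S"
      and gen: "sin (complex_of_real lam - z) \<noteq> 0" "sin (complex_of_real lam - w) \<noteq> 0"
        "sin (complex_of_real lam - (z - w)) \<noteq> 0"
      and v: "v \<in> source_fiber G (gtensor G (edge_space G) (gtensor G (edge_space G) (edge_space G))) a"
    for S a v and z w :: complex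
  proof -
    have ev: "S \<in> carrier_vec n" "\<forall>i<n. (\<Sum>j | (i, j) \<in> parcs G. S $ j) = pf_eigenvalue G * S $ i"
      "\<forall>i<n. 0 < S $ i"
      using S unfolding pf_eigenvector_def adjacency_eigenvector_iff[OF vG aG] by auto
    interpret weighted_graph G S "pf_eigenvalue G"
      by unfold_locales (use ev vG in auto)
    note f_diff = f_param_difference[OF lam gen(2) gen(1) gen(3), folded kap]
    have "f_param lam (z - w) * (1 + complex_of_real (pf_eigenvalue G) * f_param lam w
        + f_param lam w * f_param lam z) = f_param lam z - f_param lam w"
      using f_diff by simp
    from yang_baxter_of_temperley_lieb[OF E_linear F_linear temperley_lieb_source_fiber[OF v] this]
    show ?thesis unfolding op12_R_check op23_R_check .
  qed
  show ?thesis
    using pf f_param_difference[OF lam, folded kap] ybe unfolding Let_def by blast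
qed

end
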